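(* Let $Z(1;q_0,q_1)=\sum_{\pi\in\mathcal{P}_1} q_0^{\#\{\text{dark bricks in }\pi\}}q_1^{\#\{\text{light bricks in }\pi\}}\in\mathbb{Z}[[q_0,q_1]]$ be the generating function of pyramid partitions of length $1$ (defined in the context). Then, with $q=q_0q_1$ and $M(x,q)=\prod_{m\ge1}(1-xq^m)^{-m}$, \[ Z(1;q_0,q_1)=M(-q_1^{-1},q_0q_1)^{-1}\,Z(\infty;q_0,q_1),\qquad Z(\infty;q_0,q_1):=M(1,q_0q_1)^2\,M(-q_1,q_0q_1)^{-1}. \] Equivalently, \[ Z(1;q_0,q_1)=M(1,q_0q_1)^2\prod_{k\ge1}(1+q_0^kq_1^{k-1})^{k}\prod_{k\ge1}(1+q_0^kq_1^{k+1})^{k}. \]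
   Context: MacMahon function: $M(x,q)=\prod_{m=1}^{\infty}(1-xq^m)^{-m}$; note $M(-q_1^{-1},q_0q_1)^{-1}=\prod_{m\ge1}(1+q_0^mq_1^{m-1})^m$ and $M(-q_1,q_0q_1)^{-1}=\prod_{m\ge1}(1+q_0^mq_1^{m+1})^m$ are power series in $q_0,q_1$. Empty room of length $n\ge1$: its bricks are pairs $(k,p)$ with $k\in\mathbb{Z}_{\ge0}$ (the layer, counted downward from the top) and $p\in\mathbb{Z}^2$. Let $e_k=(1,0)$ if $k$ is even and $e_k=(0,1)$ if $k$ is odd. The layer sets are $B_0=\{(0,2j):0\le j\le n-1\}$ and $B_{k+1}=\{p\pm e_k: p\in B_k\}$; the empty room $\varepsilon_n$ is the set of all bricks $(k,p)$ with $p\in B_k$. Bricks in even layers are dark, bricks in odd layers are light. The brick $(k,p)$ rests upon the (two or fewer) bricks $(k+1,p\pm e_k)$ of $\varepsilon_n$ (physically: each brick rests on two side-by-side bricks of the layer below, rotated by $90^\circ$). A pyramid partition of length $n$ is a finite subset $\pi\subseteq\varepsilon_n$ such that whenever $B\in\pi$, every brick of $\varepsilon_n$ resting upon $B$ also lies in $\pi$ (i.e. $\pi$ is a finite set of bricks removable from the top so that what remains is stable). $\mathcal{P}_n$ is the set of such partitions; the weight of $\pi$ is $q_0^{\#\text{dark bricks in }\pi}q_1^{\#\text{light bricks in }\pi}$. *)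

theory Defs
  imports "HOL-Analysis.Analysis" "HOL-Computational_Algebra.Formal_Laurent_Series"
begin

type_synonym brick = "nat \<times> int \<times> int"

definition dir :: "nat \<Rightarrow> int \<times> int" where
  "dir k = (if even k then (1, 0) else (0, 1))"

fun layer :: "nat \<Rightarrow> nat \<Rightarrow> (int \<times> int) set" where
  "layer n 0 = {(0, 2 * int j) | j. j < n}"
| "layer n (Suc k) = {p + dir k | p. p \<in> layer n k} \<union> {p - dir k | p. p \<in> layer n k}"

definition empty_room :: "nat \<Rightarrow> brick set" where
  "empty_room n = {(k, p). p \<in> layer n k}"

definition rests_upon :: "brick \<Rightarrow> brick \<Rightarrow> bool" where
  "rests_upon A B \<longleftrightarrow>
     fst B = Suc (fst A) \<and> (snd B = snd A + dir (fst A) \<or> snd B = snd A - dir (fst A))"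

definition pyramid_partitions :: "nat \<Rightarrow> brick set set" where
  "pyramid_partitions n =
     {\<pi>. finite \<pi> \<and> \<pi> \<subseteq> empty_room n \<and>
          (\<forall>B\<in>\<pi>. \<forall>A\<in>empty_room n. rests_upon A B \<longrightarrow> A \<in> \<pi>)}"

definition num_dark :: "brick set \<Rightarrow> nat" where
  "num_dark \<pi> = card {B \<in> \<pi>. even (fst B)}"

definition num_light :: "brick set \<Rightarrow> nat" where
  "num_light \<pi> = card {B \<in> \<pi>. odd (fst B)}"

text \<open>
  The ring \<open>\<int>[[q\<^sub>0,q\<^sub>1]]\<close> is represented as \<open>\<int>[[q\<^sub>1]][[q\<^sub>0]]\<close>: the outer variable is \<open>q\<^sub>0\<close>
  and the coefficients are power series in \<open>q\<^sub>1\<close>. Its topology in the library is the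
  \<open>q\<^sub>0\<close>-adic one, which is finer than the \<open>(q\<^sub>0,q\<^sub>1)\<close>-adic one; every infinite product below
  converges in it, because its \<open>m\<close>-th factor is congruent to 1 modulo \<open>q\<^sub>0\<^sup>m\<close>.
\<close>

definition q0 :: "int fps fps" where "q0 = fps_X"
definition q1 :: "int fps fps" where "q1 = fps_const fps_X"

text \<open>
  The generating function, given by its coefficients; each of the sets counted is finite
  (lemma \<open>finite_pyramid_partitions_weight\<close> below).
\<close>

definition Z :: "nat \<Rightarrow> int fps fps" where
  "Z n = Abs_fps (\<lambda>i. Abs_fps (\<lambda>j.
     int (card {\<pi> \<in> pyramid_partitions n. num_dark \<pi> = i \<and> num_light \<pi> = j})))"

text \<open>
  The argument \<open>-q\<^sub>1\<^sup>-\<^sup>1\<close> of the MacMahon function is not a power series, so the identity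
  involving it lives in \<open>\<int>((q\<^sub>1))[[q\<^sub>0]]\<close>, which contains \<open>\<int>[[q\<^sub>0,q\<^sub>1]]\<close> via \<open>to_laurent\<close>.
\<close>

definition to_laurent :: "int fps fps \<Rightarrow> int fls fps" where
  "to_laurent f = Abs_fps (\<lambda>i. fps_to_fls (f $ i))"

definition l0 :: "int fls fps" where "l0 = fps_X"
definition l1 :: "int fls fps" where "l1 = fps_const fls_X"
definition l1_inv :: "int fls fps" where "l1_inv = fps_const fls_X_inv"

text \<open>
  Multiplicative inverse of a power series with constant coefficient 1. The library's
  \<open>inverse\<close> is not available here since the coefficients (in \<open>\<int>[[q\<^sub>1]]\<close> or \<open>\<int>((q\<^sub>1))\<close>) come
  without an inverse operation.
\<close>

definition fps_inv1 :: "'a::comm_ring_1 fps \<Rightarrow> 'a fps" where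
  "fps_inv1 f = fps_right_inverse f 1"

lemma fps_inv1: "f $ 0 = 1 \<Longrightarrow> f * fps_inv1 f = 1"
  unfolding fps_inv1_def by (rule fps_right_inverse) simp

definition MacMahon :: "'a::comm_ring_1 fps \<Rightarrow> 'a fps \<Rightarrow> 'a fps" where
  "MacMahon x q = (\<Prod>m. fps_inv1 (1 - x * q ^ Suc m) ^ Suc m)"

definition Z_infinity :: "'a::comm_ring_1 fps \<Rightarrow> 'a fps \<Rightarrow> 'a fps" where
  "Z_infinity x y = MacMahon 1 (x * y) ^ 2 * fps_inv1 (MacMahon (- y) (x * y))"

lemma finite_layer: "finite (layer n k)"
proof (induction k)
  case 0
  have "layer n 0 = (\<lambda>j. (0, 2 * int j)) ` {..<n}" by auto
  then show ?case by simp
next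
  case (Suc k)
  have "layer n (Suc k) = (\<lambda>p. p + dir k) ` layer n k \<union> (\<lambda>p. p - dir k) ` layer n k"
    by auto
  with Suc show ?case by simp
qed

lemma pyramid_partition_depth:
  assumes \<pi>: "\<pi> \<in> pyramid_partitions n" and "(k, p) \<in> \<pi>"
  shows "k < card \<pi>"
proof -
  have "\<exists>p. (k - i, p) \<in> \<pi>" if "i \<le> k" for i
    using that
  proof (induction i)
    case 0
    then show ?case using assms(2) by (metis diff_zero)
  next
    case (Suc i)
    then obtain r where r: "(k - i, r) \<in> \<pi>" by auto
    define l where "l = k - Suc i"
    have l: "k - i = Suc l" using Suc.prems by (simp add: l_def)
    have sub: "(Suc l, r) \<in> empty_room n"
      and closed: "\<And>A. A \<in> empty_room n \<Longrightarrow> rests_upon A (Suc l, r) \<Longrightarrow> A \<in> \<pi>"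
      using r \<pi> unfolding pyramid_partitions_def l by blast+
    from sub have "r \<in> layer n (Suc l)"
      unfolding empty_room_def by blast
    then obtain s where s: "s \<in> layer n l" "r = s + dir l \<or> r = s - dir l"
      unfolding layer.simps by blast
    have "(l, s) \<in> empty_room n" using s(1) unfolding empty_room_def by blast
    moreover have "rests_upon (l, s) (Suc l, r)" using s(2) by (simp add: rests_upon_def)
    ultimately have "(l, s) \<in> \<pi>" by (rule closed)
    then show ?case unfolding l_def by blast
  qed
  then have "l \<in> fst ` \<pi>" if "l \<le> k" for l
    using that by (metis diff_diff_cancel diff_le_self fst_conv imageI)
  then have "{..k} \<subseteq> fst ` \<pi>" by auto
  moreover have "finite \<pi>" using \<pi> by (simp add: pyramid_partitions_def)
  ultimately have "card {..k} \<le> card \<pi>"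
    by (meson card_image_le card_mono finite_imageI le_trans)
  then show ?thesis by simp
qed

lemma finite_pyramid_partitions_weight:
  "finite {\<pi> \<in> pyramid_partitions n. num_dark \<pi> = i \<and> num_light \<pi> = j}"
proof (rule finite_subset)
  show "finite (Pow (Sigma {..<i + j} (layer n)))"
    by (simp add: finite_layer)
  show "{\<pi> \<in> pyramid_partitions n. num_dark \<pi> = i \<and> num_light \<pi> = j}
          \<subseteq> Pow (Sigma {..<i + j} (layer n))"
  proof (intro subsetI PowI)
    fix \<pi> B
    assume "\<pi> \<in> {\<pi> \<in> pyramid_partitions n. num_dark \<pi> = i \<and> num_light \<pi> = j}" and "B \<in> \<pi>"
    moreover obtain k p where "B = (k, p)" by (cases B)
    ultimately have \<pi>: "\<pi> \<in> pyramid_partitions n" and B: "(k, p) \<in> \<pi>" "B = (k, p)"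
      and ij: "num_dark \<pi> = i" "num_light \<pi> = j" by auto
    have fin: "finite \<pi>" using \<pi> by (simp add: pyramid_partitions_def)
    have "card ({B \<in> \<pi>. even (fst B)} \<union> {B \<in> \<pi>. odd (fst B)}) = num_dark \<pi> + num_light \<pi>"
      unfolding num_dark_def num_light_def by (rule card_Un_disjoint) (use fin in auto)
    moreover have "{B \<in> \<pi>. even (fst B)} \<union> {B \<in> \<pi>. odd (fst B)} = \<pi>" by auto
    ultimately have "k < i + j"
      using pyramid_partition_depth[OF \<pi> B(1)] ij by simp
    moreover have "p \<in> layer n k"
      using \<pi> B(1) by (auto simp: pyramid_partitions_def empty_room_def)
    ultimately show "B \<in> Sigma {..<i + j} (layer n)" using B(2) by simp
  qed
qed

end

theory Submission
  imports Defs
begin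

text \<open>
  Cut the pyramid into the slices \<open>x + y = t\<close>. The bricks of a slice form a quadrant, ordered as
  \<open>\<nat> \<times> \<nat>\<close>, so the removed bricks of a slice form an integer partition \<open>\<lambda>(t)\<close>; slices with
  even \<open>t\<close> are dark and those with odd \<open>t\<close> are light. Stability means that the partitions increase
  up to \<open>t = 0\<close> and decrease afterwards, consecutive ones differing alternately by horizontal and by
  vertical strips. The generating function is thus a vacuum expectation value of a product of
  creation and annihilation vertex operators of both kinds. Moving every up-operator to the right
  past every down-operator contributes \<open>1 / (1 - w)\<close> for two operators of the same kind and
  \<open>1 + w\<close> for two of different kinds, where \<open>w\<close> is the product of the weights of the slices between
  them; the product of these factors is the asserted one.
\<close>

unbundle no vec_syntax

section \<open>Locally finite sums of formal power series\<close>

definition loc_fin :: "('b \<Rightarrow> 'a::comm_ring_1 fps) \<Rightarrow> 'b set \<Rightarrow> bool" where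
  "loc_fin f A \<longleftrightarrow> (\<forall>i. finite {x \<in> A. f x $ i \<noteq> 0})"

definition fsum :: "('b \<Rightarrow> 'a::comm_ring_1 fps) \<Rightarrow> 'b set \<Rightarrow> 'a fps" where
  "fsum f A = Abs_fps (\<lambda>i. \<Sum>x | x \<in> A \<and> f x $ i \<noteq> 0. f x $ i)"

lemma fsum_nth:
  assumes "finite B" "B \<subseteq> A" "\<And>x. x \<in> A - B \<Longrightarrow> f x $ i = 0"
  shows "fsum f A $ i = (\<Sum>x\<in>B. f x $ i)"
  unfolding fsum_def fps_nth_Abs_fps
  by (rule sum.mono_neutral_left) (use assms in auto)

lemma fsum_finite: "finite A \<Longrightarrow> fsum f A = sum f A"
  by (rule fps_ext) (subst fsum_nth[of A], auto simp: fps_sum_nth)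

lemma loc_fin_finite: "finite A \<Longrightarrow> loc_fin f A"
  by (simp add: loc_fin_def)

lemma fsum_cong: "A = B \<Longrightarrow> (\<And>x. x \<in> B \<Longrightarrow> f x = g x) \<Longrightarrow> fsum f A = fsum g B"
  unfolding fsum_def by (auto intro!: arg_cong[of _ _ Abs_fps] sum.cong)

lemma loc_fin_cong: "A = B \<Longrightarrow> (\<And>x. x \<in> B \<Longrightarrow> f x = g x) \<Longrightarrow> loc_fin f A = loc_fin g B"
  unfolding loc_fin_def by (intro arg_cong[of _ _ All] ext arg_cong[of _ _ finite]) auto

lemma loc_fin_le: "loc_fin f A \<Longrightarrow> finite {x \<in> A. \<exists>k\<le>i. f x $ k \<noteq> 0}"
proof -
  assume "loc_fin f A"
  then have "finite (\<Union>k\<le>i. {x \<in> A. f x $ k \<noteq> 0})"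
    by (auto simp: loc_fin_def)
  moreover have "(\<Union>k\<le>i. {x \<in> A. f x $ k \<noteq> 0}) = {x \<in> A. \<exists>k\<le>i. f x $ k \<noteq> 0}"
    by auto
  ultimately show ?thesis by simp
qed

lemma loc_fin_reindex:
  assumes "bij_betw h A B" "loc_fin (\<lambda>x. g (h x)) A"
  shows "loc_fin g B"
  unfolding loc_fin_def
proof
  fix i
  have "{x \<in> B. g x $ i \<noteq> 0} = h ` {x \<in> A. g (h x) $ i \<noteq> 0}"
    using assms(1) by (auto simp: bij_betw_def)
  then show "finite {x \<in> B. g x $ i \<noteq> 0}"
    using assms(2) by (simp add: loc_fin_def)
qed

lemma fsum_reindex:
  assumes "bij_betw h A B"
  shows "fsum (\<lambda>x. g (h x)) A = fsum g B"
proof (rule fps_ext)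
  fix i
  have "bij_betw h {x \<in> A. g (h x) $ i \<noteq> 0} {x \<in> B. g x $ i \<noteq> 0}"
    using assms by (auto simp: bij_betw_def inj_on_def)
  then show "fsum (\<lambda>x. g (h x)) A $ i = fsum g B $ i"
    by (simp add: fsum_def sum.reindex_bij_betw[of h _ _ "\<lambda>x. g x $ i"])
qed

lemma fsum_cmult:
  assumes "loc_fin f A"
  shows "fsum (\<lambda>x. c * f x) A = c * fsum f A"
proof (rule fps_ext)
  fix i
  let ?B = "{x \<in> A. \<exists>k\<le>i. f x $ k \<noteq> 0}"
  have fin: "finite ?B" using assms by (rule loc_fin_le)
  have zero: "f x $ k = 0" if "x \<in> A - ?B" "k \<le> i" for x k
    using that by auto
  have "fsum (\<lambda>x. c * f x) A $ i = (\<Sum>x\<in>?B. (c * f x) $ i)"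
  proof (rule fsum_nth[OF fin])
    show "(c * f x) $ i = 0" if "x \<in> A - ?B" for x
      unfolding fps_mult_nth by (rule sum.neutral) (simp add: zero[OF that])
  qed auto
  also have "\<dots> = (\<Sum>k=0..i. c $ k * (\<Sum>x\<in>?B. f x $ (i - k)))"
    unfolding fps_mult_nth by (subst sum.swap) (simp add: sum_distrib_left)
  also have "\<dots> = (\<Sum>k=0..i. c $ k * fsum f A $ (i - k))"
    by (intro sum.cong refl arg_cong2[of _ _ _ _ "(*)"] fsum_nth[symmetric] fin zero) auto
  finally show "fsum (\<lambda>x. c * f x) A $ i = (c * fsum f A) $ i"
    by (simp add: fps_mult_nth)
qed

lemma loc_fin_cmult:
  assumes "loc_fin f A"
  shows "loc_fin (\<lambda>x. c * f x) A"
  unfolding loc_fin_def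
proof
  fix i
  have "{x \<in> A. (c * f x) $ i \<noteq> 0} \<subseteq> {x \<in> A. \<exists>k\<le>i. f x $ k \<noteq> 0}"
  proof clarsimp
    fix x assume "(c * f x) $ i \<noteq> 0"
    then obtain k where "k \<le> i" "c $ k * f x $ (i - k) \<noteq> 0"
      unfolding fps_mult_nth by (metis (no_types, lifting) atLeastAtMost_iff sum.neutral)
    then show "\<exists>k\<le>i. f x $ k \<noteq> 0"
      by (metis diff_le_self mult_zero_right)
  qed
  then show "finite {x \<in> A. (c * f x) $ i \<noteq> 0}"
    using loc_fin_le[OF assms] finite_subset by blast
qed

lemma fsum_Sigma:
  assumes "loc_fin (\<lambda>(x, y). f x y) (Sigma A B)"
  shows "fsum (\<lambda>x. fsum (f x) (B x)) A = fsum (\<lambda>(x, y). f x y) (Sigma A B)"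
proof (rule fps_ext)
  fix i
  let ?S = "{z \<in> Sigma A B. (case z of (x, y) \<Rightarrow> f x y) $ i \<noteq> 0}"
  let ?T = "\<lambda>x. {y \<in> B x. f x y $ i \<noteq> 0}"
  have fin: "finite ?S" using assms by (simp add: loc_fin_def)
  have finT: "finite (?T x)" if "x \<in> A" for x
    by (rule finite_subset[OF _ finite_imageI[OF fin, of snd]]) (use that in force)
  have S: "?S = Sigma (fst ` ?S) ?T" by force
  have inner: "fsum (f x) (B x) $ i = (\<Sum>y\<in>?T x. f x y $ i)" if "x \<in> A" for x
    by (rule fsum_nth) (use finT that in auto)
  have "fsum (\<lambda>x. fsum (f x) (B x)) A $ i = (\<Sum>x\<in>fst ` ?S. fsum (f x) (B x) $ i)"
  proof (rule fsum_nth)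
    fix x assume "x \<in> A - fst ` ?S"
    then have "x \<in> A" "?T x = {}" by force+
    then show "fsum (f x) (B x) $ i = 0" by (simp add: inner)
  qed (use fin in auto)
  also have "\<dots> = (\<Sum>x\<in>fst ` ?S. \<Sum>y\<in>?T x. f x y $ i)"
    by (rule sum.cong) (auto simp: inner)
  also have "\<dots> = (\<Sum>(x, y)\<in>Sigma (fst ` ?S) ?T. f x y $ i)"
    by (rule sum.Sigma) (use fin finT in auto)
  also have "\<dots> = (\<Sum>(x, y)\<in>?S. f x y $ i)"
    using S by simp
  also have "\<dots> = fsum (\<lambda>(x, y). f x y) (Sigma A B) $ i"
    by (simp add: fsum_def case_prod_unfold)
  finally show "fsum (\<lambda>x. fsum (f x) (B x)) A $ i = fsum (\<lambda>(x, y). f x y) (Sigma A B) $ i" .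
qed

lemma loc_fin_Sigma_mult:
  assumes "loc_fin g A" "\<And>x. x \<in> A \<Longrightarrow> loc_fin (h x) (B x)"
  shows "loc_fin (\<lambda>(x, y). g x * h x y) (Sigma A B)"
  unfolding loc_fin_def
proof
  fix i
  have "{z \<in> Sigma A B. (case z of (x, y) \<Rightarrow> g x * h x y) $ i \<noteq> 0}
      \<subseteq> Sigma {x \<in> A. \<exists>k\<le>i. g x $ k \<noteq> 0} (\<lambda>x. {y \<in> B x. \<exists>k\<le>i. h x y $ k \<noteq> 0})"
  proof clarsimp
    fix x y assume "(g x * h x y) $ i \<noteq> 0"
    then obtain k where "k \<le> i" "g x $ k * h x y $ (i - k) \<noteq> 0"
      unfolding fps_mult_nth by (metis (no_types, lifting) atLeastAtMost_iff sum.neutral)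
    then show "(\<exists>k\<le>i. g x $ k \<noteq> 0) \<and> (\<exists>k\<le>i. h x y $ k \<noteq> 0)"
      by (metis diff_le_self mult_zero_left mult_zero_right)
  qed
  moreover have "finite (Sigma {x \<in> A. \<exists>k\<le>i. g x $ k \<noteq> 0} (\<lambda>x. {y \<in> B x. \<exists>k\<le>i. h x y $ k \<noteq> 0}))"
    by (intro finite_SigmaI) (use assms loc_fin_le in auto)
  ultimately show "finite {z \<in> Sigma A B. (case z of (x, y) \<Rightarrow> g x * h x y) $ i \<noteq> 0}"
    by (rule finite_subset)
qed

lemma fsum_Sigma_mult:
  assumes "loc_fin g A" "\<And>x. x \<in> A \<Longrightarrow> loc_fin (h x) (B x)"
  shows "fsum (\<lambda>x. g x * fsum (h x) (B x)) A = fsum (\<lambda>(x, y). g x * h x y) (Sigma A B)"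
proof -
  have "fsum (\<lambda>x. g x * fsum (h x) (B x)) A = fsum (\<lambda>x. fsum (\<lambda>y. g x * h x y) (B x)) A"
    by (rule fsum_cong) (use assms in \<open>auto simp: fsum_cmult\<close>)
  also have "\<dots> = fsum (\<lambda>(x, y). g x * h x y) (Sigma A B)"
    by (rule fsum_Sigma) (rule loc_fin_Sigma_mult[OF assms])
  finally show ?thesis .
qed

lemma loc_fin_subset: "loc_fin f A \<Longrightarrow> B \<subseteq> A \<Longrightarrow> loc_fin f B"
  unfolding loc_fin_def
proof
  fix i assume "\<forall>i. finite {x \<in> A. f x $ i \<noteq> 0}" "B \<subseteq> A"
  then show "finite {x \<in> B. f x $ i \<noteq> 0}"
    by (intro finite_subset[of "{x \<in> B. f x $ i \<noteq> 0}" "{x \<in> A. f x $ i \<noteq> 0}"]) auto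
qed

lemma loc_fin_mult:
  assumes "loc_fin g A"
  shows "loc_fin (\<lambda>x. g x * h x) A"
proof -
  have "loc_fin (\<lambda>(x, y). g x * h x) (A \<times> {()})"
    by (rule loc_fin_Sigma_mult[where h = "\<lambda>x y. h x"]) (auto simp: assms loc_fin_finite)
  moreover have "bij_betw fst (A \<times> {()}) A"
    by (auto simp: bij_betw_def inj_on_def)
  ultimately show ?thesis
    by (intro loc_fin_reindex[of fst "A \<times> {()}"]) (auto simp: case_prod_unfold)
qed

lemma fsum_Sigma_swap:
  assumes "loc_fin (\<lambda>(x, y). f x y) (Sigma A B)"
    and "\<And>x y. x \<in> A \<and> y \<in> B x \<longleftrightarrow> y \<in> C \<and> x \<in> D y"
  shows "fsum (\<lambda>(x, y). f x y) (Sigma A B) = fsum (\<lambda>y. fsum (\<lambda>x. f x y) (D y)) C"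
proof -
  have bij: "bij_betw prod.swap (Sigma A B) (Sigma C D)"
  proof (rule bij_betw_byWitness[where f' = prod.swap])
    show "prod.swap ` Sigma A B \<subseteq> Sigma C D" "prod.swap ` Sigma C D \<subseteq> Sigma A B"
      using assms(2) by fastforce+
  qed auto
  have "loc_fin (\<lambda>(y, x). f x y) (Sigma C D)"
    by (rule loc_fin_reindex[OF bij]) (use assms(1) in \<open>simp add: case_prod_unfold\<close>)
  then have "fsum (\<lambda>y. fsum (\<lambda>x. f x y) (D y)) C = fsum (\<lambda>(y, x). f x y) (Sigma C D)"
    by (rule fsum_Sigma)
  also have "\<dots> = fsum (\<lambda>z. (\<lambda>(y, x). f x y) (prod.swap z)) (Sigma A B)"
    by (rule fsum_reindex[OF bij, symmetric])
  finally show ?thesis by (simp add: case_prod_unfold)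
qed

lemma fps_X_power_dvd_iff: "fps_X ^ n dvd (h :: 'a::comm_ring_1 fps) \<longleftrightarrow> (\<forall>k<n. h $ k = 0)"
proof
  assume "\<forall>k<n. h $ k = 0"
  then have "h = fps_X ^ n * fps_shift n h"
    by (intro fps_ext) (simp add: fps_X_power_mult_nth)
  then show "fps_X ^ n dvd h" by (metis dvd_triv_left)
qed (auto simp: dvd_def fps_X_power_mult_nth)

lemma fps_X_dvd_iff: "fps_X dvd (h :: 'a::comm_ring_1 fps) \<longleftrightarrow> h $ 0 = 0"
  using fps_X_power_dvd_iff[of 1 h] by simp

lemma fps_power_nth_eq_0:
  assumes "(x :: 'a::comm_ring_1 fps) $ 0 = 0" "i < n"
  shows "x ^ n $ i = 0"
proof -
  have "fps_X ^ n dvd x ^ n" using assms(1) by (simp add: dvd_power_same fps_X_dvd_iff)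
  then show ?thesis using assms(2) by (auto simp: fps_X_power_dvd_iff)
qed

lemma loc_fin_powers: "(x :: 'a::comm_ring_1 fps) $ 0 = 0 \<Longrightarrow> loc_fin (\<lambda>n. x ^ n) UNIV"
  unfolding loc_fin_def
proof
  fix i assume "x $ 0 = 0"
  then have "{n \<in> UNIV. x ^ n $ i \<noteq> 0} \<subseteq> {..i}"
    by (auto simp: linorder_not_less[symmetric] fps_power_nth_eq_0)
  then show "finite {n \<in> UNIV. x ^ n $ i \<noteq> 0}" by (rule finite_subset) simp
qed

lemma fps_inv1_unique:
  fixes f :: "'a::comm_ring_1 fps"
  assumes "f $ 0 = 1" "f * g = 1"
  shows "fps_inv1 f = g"
proof -
  have "fps_inv1 f = fps_inv1 f * (f * g)" using assms by simp
  also have "\<dots> = (f * fps_inv1 f) * g" by (simp only: mult_ac)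
  finally show ?thesis using assms by (simp add: fps_inv1)
qed

lemma fps_inv1_geometric:
  fixes x :: "'a::comm_ring_1 fps"
  assumes "x $ 0 = 0"
  shows "fps_inv1 (1 - x) = fsum (\<lambda>n. x ^ n) UNIV"
proof (rule fps_inv1_unique)
  have pow: "x ^ n $ i = 0" if "i < n" for n i
    using assms that by (rule fps_power_nth_eq_0)
  have nth: "fsum f UNIV $ i = (\<Sum>n\<le>i. f n $ i)" if "\<And>n. i < n \<Longrightarrow> f n $ i = 0"
    for f :: "nat \<Rightarrow> 'a fps" and i
    by (rule fsum_nth) (use that in auto)
  have "x * fsum (\<lambda>n. x ^ n) UNIV + 1 = fsum (\<lambda>n. x ^ n) UNIV"
  proof (rule fps_ext)
    fix i
    have "(x * fsum (\<lambda>n. x ^ n) UNIV + 1) $ i = fsum (\<lambda>n. x ^ Suc n) UNIV $ i + 1 $ i"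
      using fsum_cmult[OF loc_fin_powers[OF assms], of x] by simp
    also have "\<dots> = (\<Sum>n\<le>i. x ^ Suc n $ i) + x ^ 0 $ i"
      by (subst nth) (auto simp only: pow less_SucI power_0)
    also have "\<dots> = (\<Sum>n\<le>Suc i. x ^ n $ i)"
      by (subst sum.atMost_Suc_shift) (simp add: add.commute)
    also have "\<dots> = (\<Sum>n\<le>i. x ^ n $ i)"
      using pow[of i "Suc i"] by (simp del: power_Suc)
    also have "\<dots> = fsum (\<lambda>n. x ^ n) UNIV $ i"
      by (subst nth) (simp_all add: pow)
    finally show "(x * fsum (\<lambda>n. x ^ n) UNIV + 1) $ i = fsum (\<lambda>n. x ^ n) UNIV $ i" .
  qed
  then show "(1 - x) * fsum (\<lambda>n. x ^ n) UNIV = 1" by (simp add: algebra_simps)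
qed (use assms in simp)

section \<open>Partitions, strips and Cauchy kernels\<close>

definition parts :: "(nat \<Rightarrow> nat) set" where
  "parts = {f. antimono f \<and> (\<exists>n. \<forall>i\<ge>n. f i = 0)}"

definition psize :: "(nat \<Rightarrow> nat) \<Rightarrow> nat" where
  "psize f = card {(i, j). j < f i}"

definition hstrip :: "(nat \<Rightarrow> nat) \<Rightarrow> (nat \<Rightarrow> nat) \<Rightarrow> bool" where
  "hstrip g f \<longleftrightarrow> (\<forall>i. g i \<le> f i \<and> f (Suc i) \<le> g i)"

definition vstrip :: "(nat \<Rightarrow> nat) \<Rightarrow> (nat \<Rightarrow> nat) \<Rightarrow> bool" where
  "vstrip g f \<longleftrightarrow> (\<forall>i. g i \<le> f i \<and> f i \<le> Suc (g i))"

definition conj_part :: "(nat \<Rightarrow> nat) \<Rightarrow> nat \<Rightarrow> nat" where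
  "conj_part f j = card {i. j < f i}"

lemma zero_in_parts: "(\<lambda>_. 0) \<in> parts"
  by (simp add: parts_def antimono_def)

lemma psize_eq_sum:
  assumes "\<And>i. n \<le> i \<Longrightarrow> f i = 0"
  shows "psize f = (\<Sum>i<n. f i)"
proof -
  have "{(i, j). j < f i} = Sigma {..<n} (\<lambda>i. {..<f i})"
    using assms by (auto simp: not_le[symmetric])
  then show ?thesis by (simp add: psize_def)
qed

lemma psize_mono:
  assumes "f \<in> parts" "\<And>i. g i \<le> f i"
  shows "psize g \<le> psize f"
proof -
  obtain n where n: "\<And>i. n \<le> i \<Longrightarrow> f i = 0" using assms(1) by (auto simp: parts_def)
  then have "\<And>i. n \<le> i \<Longrightarrow> g i = 0" by (metis assms(2) le_zero_eq)
  with n show ?thesis by (simp add: psize_eq_sum[of n] assms(2) sum_mono)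
qed

lemma finite_parts_psize_le: "finite {f \<in> parts. psize f \<le> n}"
proof (rule finite_subset)
  let ?S = "{f. \<forall>i. (i \<in> {..n} \<longrightarrow> f i \<in> {..n}) \<and> (i \<notin> {..n} \<longrightarrow> f i = 0)}"
  show "finite ?S" by (rule finite_set_of_finite_funs) auto
  show "{f \<in> parts. psize f \<le> n} \<subseteq> ?S"
  proof clarify
    fix f i assume f: "f \<in> parts" "psize f \<le> n"
    obtain m where m: "\<And>i. m \<le> i \<Longrightarrow> f i = 0" using f(1) by (auto simp: parts_def)
    have anti: "antimono f" using f(1) by (simp add: parts_def)
    have sum: "psize f = (\<Sum>k<max m (Suc i). f k)"
      by (rule psize_eq_sum) (use m in auto)
    have "f i \<le> psize f"
      unfolding sum by (rule member_le_sum) auto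
    moreover have "i < psize f" if "f i \<noteq> 0"
    proof -
      have "Suc i = (\<Sum>k<Suc i. 1)" by simp
      also have "\<dots> \<le> (\<Sum>k<Suc i. f k)"
      proof (rule sum_mono)
        fix k assume "k \<in> {..<Suc i}"
        then have "f i \<le> f k" using anti by (auto simp: antimono_def)
        then show "1 \<le> f k" using that by simp
      qed
      also have "\<dots> \<le> psize f"
        unfolding sum by (rule sum_mono2) auto
      finally show ?thesis by simp
    qed
    ultimately show "(i \<in> {..n} \<longrightarrow> f i \<in> {..n}) \<and> (i \<notin> {..n} \<longrightarrow> f i = 0)"
      using f(2) by (cases "f i = 0") auto
  qed
qed

lemma hstrip_parts:
  assumes "hstrip g f"
  shows "g \<in> parts \<longleftrightarrow> f \<in> parts"
proof -
  have "antimono g" "antimono f"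
    using assms unfolding hstrip_def antimono_iff_le_Suc by (meson order_trans)+
  moreover have "f i = 0" if "\<forall>i\<ge>n. g i = 0" "i \<ge> Suc n" for n i
    using that assms unfolding hstrip_def
    by (metis Suc_le_D Suc_le_mono le_zero_eq)
  moreover have "g i = 0" if "\<forall>i\<ge>n. f i = 0" "i \<ge> n" for n i
    using that assms unfolding hstrip_def by (metis le_zero_eq)
  ultimately show ?thesis unfolding parts_def by blast
qed

lemma mem_iff_less_card:
  fixes S :: "nat set"
  assumes "finite S" "\<And>i j. j \<in> S \<Longrightarrow> i \<le> j \<Longrightarrow> i \<in> S"
  shows "i \<in> S \<longleftrightarrow> i < card S"
proof -
  have "\<exists>n. S = {..<n}"
  proof (cases "S = {}")
    case True
    then show ?thesis by (intro exI[of _ 0]) simp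
  next
    case False
    then have "S = {..<Suc (Max S)}"
      using assms(1) by (auto simp: less_Suc_eq_le intro: assms(2)[OF Max_in])
    then show ?thesis ..
  qed
  then obtain n where "S = {..<n}" ..
  then show ?thesis by simp
qed

lemma less_conj_part_iff:
  assumes "f \<in> parts"
  shows "i < conj_part f j \<longleftrightarrow> j < f i"
proof -
  obtain n where n: "\<And>i. n \<le> i \<Longrightarrow> f i = 0" using assms by (auto simp: parts_def)
  have "i \<in> {i. j < f i} \<longleftrightarrow> i < card {i. j < f i}"
  proof (rule mem_iff_less_card)
    have "{i. j < f i} \<subseteq> {..<n}" using n by (auto simp: not_le[symmetric])
    then show "finite {i. j < f i}" by (rule finite_subset) simp
    show "\<And>i k. k \<in> {i. j < f i} \<Longrightarrow> i \<le> k \<Longrightarrow> i \<in> {i. j < f i}"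
      using assms by (auto simp: parts_def antimono_def intro: less_le_trans)
  qed
  then show ?thesis by (simp add: conj_part_def)
qed

lemma conj_part_in_parts:
  assumes "f \<in> parts"
  shows "conj_part f \<in> parts"
proof -
  have "conj_part f (Suc j) \<le> conj_part f j" for j
    by (rule ccontr) (metis assms less_conj_part_iff Suc_lessD less_irrefl not_le)
  moreover have "conj_part f j = 0" if "f 0 \<le> j" for j
    using that by (metis assms less_conj_part_iff not_le gr0I)
  ultimately show ?thesis
    by (auto simp: parts_def antimono_iff_le_Suc)
qed

lemma conj_part_conj_part:
  assumes "f \<in> parts"
  shows "conj_part (conj_part f) = f"
proof
  fix i
  have "j < conj_part (conj_part f) i \<longleftrightarrow> j < f i" for j
    using assms by (simp add: less_conj_part_iff conj_part_in_parts)
  then show "conj_part (conj_part f) i = f i"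
    by (meson less_irrefl nat_neq_iff)
qed

lemma psize_conj_part:
  assumes "f \<in> parts"
  shows "psize (conj_part f) = psize f"
proof -
  have "{(i, j). j < conj_part f i} = prod.swap ` {(i, j). j < f i}"
    using assms by (auto simp: less_conj_part_iff image_iff)
  then show ?thesis by (simp add: psize_def card_image)
qed

lemma hstrip_conj_part:
  assumes "f \<in> parts" "g \<in> parts"
  shows "hstrip (conj_part g) (conj_part f) \<longleftrightarrow> vstrip g f"
proof -
  have le: "conj_part g i \<le> conj_part f i' \<longleftrightarrow> (\<forall>j. i < g j \<longrightarrow> i' < f j)"
    if "f \<in> parts" "g \<in> parts" for f g i i'
    using that by (metis less_conj_part_iff less_le_trans not_le less_irrefl)
  have "hstrip (conj_part g) (conj_part f) \<longleftrightarrow>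
    (\<forall>j. (\<forall>i. i < g j \<longrightarrow> i < f j) \<and> (\<forall>i. Suc i < f j \<longrightarrow> i < g j))"
    unfolding hstrip_def le[OF assms] le[OF assms(2,1)] by blast
  also have "\<dots> \<longleftrightarrow> vstrip g f"
  proof -
    have "(\<forall>i. i < g j \<longrightarrow> i < f j) \<longleftrightarrow> g j \<le> f j" for j
      by (meson less_le_trans not_le less_irrefl)
    moreover have "(\<forall>i. Suc i < f j \<longrightarrow> i < g j) \<longleftrightarrow> f j \<le> Suc (g j)" for j
      by (auto simp: not_less[symmetric])
    ultimately show ?thesis by (simp add: vstrip_def)
  qed
  finally show ?thesis .
qed

lemma common_vanishing_bound:
  assumes "f \<in> parts" "g \<in> parts"
  obtains n where "\<And>i. n \<le> i \<Longrightarrow> f i = 0" "\<And>i. n \<le> i \<Longrightarrow> g i = 0"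
proof -
  obtain k l where "\<forall>i\<ge>k. f i = 0" "\<forall>i\<ge>l. g i = 0"
    using assms by (auto simp: parts_def)
  then show thesis by (intro that[of "max k l"]) auto
qed

lemma Cauchy_kernel_hh:
  fixes u y :: "'a::comm_ring_1 fps"
  assumes "\<mu> \<in> parts" "\<nu> \<in> parts" "u $ 0 = 0"
  shows "fsum (\<lambda>l. u ^ (psize l - psize \<mu>) * y ^ (psize l - psize \<nu>))
           {l \<in> parts. hstrip \<mu> l \<and> hstrip \<nu> l} =
         fps_inv1 (1 - u * y) *
         fsum (\<lambda>\<kappa>. u ^ (psize \<nu> - psize \<kappa>) * y ^ (psize \<mu> - psize \<kappa>))
           {\<kappa> \<in> parts. hstrip \<kappa> \<mu> \<and> hstrip \<kappa> \<nu>}"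
    (is "fsum ?F ?L = _ * fsum ?G ?K")
proof -
  \<comment> \<open>Row \<open>k + 1\<close> of \<open>\<lambda>\<close> and row \<open>k\<close> of \<open>\<kappa>\<close> range over the same interval, so reflecting that interval
    exchanges them; row \<open>0\<close> of \<open>\<lambda>\<close> is unbounded above and yields the geometric series.\<close>
  define lo hi where "lo i = max (\<mu> i) (\<nu> i)" and "hi i = min (\<mu> i) (\<nu> i)" for i
  define \<beta> where "\<beta> = (\<lambda>(n, \<kappa> :: nat \<Rightarrow> nat) i. case i of 0 \<Rightarrow> lo 0 + n | Suc k \<Rightarrow> hi k + lo (Suc k) - \<kappa> k)"
  define \<gamma> where "\<gamma> = (\<lambda>l :: nat \<Rightarrow> nat. (l 0 - lo 0, \<lambda>k. hi k + lo (Suc k) - l (Suc k)))"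
  have L: "l \<in> ?L \<longleftrightarrow> lo 0 \<le> l 0 \<and> (\<forall>k. lo (Suc k) \<le> l (Suc k) \<and> l (Suc k) \<le> hi k)" for l
  proof -
    have "l \<in> ?L \<longleftrightarrow> hstrip \<mu> l \<and> hstrip \<nu> l"
      using assms hstrip_parts by blast
    also have "\<dots> \<longleftrightarrow> (\<forall>k. lo k \<le> l k \<and> l (Suc k) \<le> hi k)"
      unfolding hstrip_def lo_def hi_def by auto
    also have "\<dots> \<longleftrightarrow> lo 0 \<le> l 0 \<and> (\<forall>k. lo (Suc k) \<le> l (Suc k) \<and> l (Suc k) \<le> hi k)"
      by (metis old.nat.exhaust)
    finally show ?thesis .
  qed
  have K: "\<kappa> \<in> ?K \<longleftrightarrow> (\<forall>k. lo (Suc k) \<le> \<kappa> k \<and> \<kappa> k \<le> hi k)" for \<kappa>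
  proof -
    have "\<kappa> \<in> ?K \<longleftrightarrow> hstrip \<kappa> \<mu> \<and> hstrip \<kappa> \<nu>"
      using assms hstrip_parts by blast
    then show ?thesis unfolding hstrip_def lo_def hi_def by auto
  qed
  have reflect: "a \<le> b + a - k \<and> b + a - k \<le> b" if "a \<le> k \<and> k \<le> b" for a b k :: nat
    using that by auto
  have bij: "bij_betw \<beta> (UNIV \<times> ?K) ?L"
  proof (rule bij_betw_byWitness[where f' = \<gamma>])
    show "\<forall>a\<in>UNIV \<times> ?K. \<gamma> (\<beta> a) = a"
    proof
      fix a :: "nat \<times> (nat \<Rightarrow> nat)" assume "a \<in> UNIV \<times> ?K"
      then obtain n \<kappa> where a: "a = (n, \<kappa>)" "\<kappa> \<in> ?K" by blast
      then have "\<kappa> k \<le> hi k" for k by (simp only: K)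
      then show "\<gamma> (\<beta> a) = a"
        by (auto simp: a \<gamma>_def \<beta>_def fun_eq_iff trans_le_add1)
    qed
    show "\<forall>l\<in>?L. \<beta> (\<gamma> l) = l"
    proof
      fix l assume "l \<in> ?L"
      then have "lo 0 \<le> l 0" "l (Suc k) \<le> hi k" for k by (simp_all only: L)
      then show "\<beta> (\<gamma> l) = l"
        by (auto simp: \<gamma>_def \<beta>_def fun_eq_iff trans_le_add1 split: nat.split)
    qed
    show "\<beta> ` (UNIV \<times> ?K) \<subseteq> ?L"
    proof
      fix l assume "l \<in> \<beta> ` (UNIV \<times> ?K)"
      then obtain n \<kappa> where l: "l = \<beta> (n, \<kappa>)" "\<kappa> \<in> ?K" by blast
      then have "lo (Suc k) \<le> \<kappa> k \<and> \<kappa> k \<le> hi k" for k by (simp only: K)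
      then have "lo (Suc k) \<le> hi k + lo (Suc k) - \<kappa> k \<and> hi k + lo (Suc k) - \<kappa> k \<le> hi k" for k
        by (rule reflect)
      then show "l \<in> ?L" unfolding L by (simp add: l(1) \<beta>_def)
    qed
    show "\<gamma> ` ?L \<subseteq> UNIV \<times> ?K"
    proof
      fix a assume "a \<in> \<gamma> ` ?L"
      then obtain l where l: "l \<in> ?L" "a = \<gamma> l" by blast
      then have "lo (Suc k) \<le> l (Suc k) \<and> l (Suc k) \<le> hi k" for k by (simp only: L)
      then have "lo (Suc k) \<le> hi k + lo (Suc k) - l (Suc k) \<and> hi k + lo (Suc k) - l (Suc k) \<le> hi k" for k
        by (rule reflect)
      then have "snd a \<in> ?K" unfolding K by (simp add: l(2) \<gamma>_def)
      then show "a \<in> UNIV \<times> ?K" by (metis UNIV_I mem_Times_iff)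
    qed
  qed
  obtain N where N: "\<And>i. N \<le> i \<Longrightarrow> \<mu> i = 0" "\<And>i. N \<le> i \<Longrightarrow> \<nu> i = 0"
    using common_vanishing_bound[OF assms(1,2)] by blast
  have size: "psize (\<beta> (n, \<kappa>)) + psize \<kappa> = psize \<mu> + psize \<nu> + n" if "\<kappa> \<in> ?K" for n \<kappa>
  proof -
    have \<kappa>: "lo (Suc k) \<le> \<kappa> k" "\<kappa> k \<le> hi k" for k using that by (simp_all only: K)
    have \<kappa>0: "\<kappa> i = 0" if "N \<le> i" for i
      using \<kappa>(2)[of i] N that by (simp add: hi_def)
    have "\<beta> (n, \<kappa>) i = 0" if "Suc N \<le> i" for i
      using that N by (cases i) (auto simp: \<beta>_def lo_def hi_def)
    then have "psize (\<beta> (n, \<kappa>)) = (\<Sum>i<Suc N. \<beta> (n, \<kappa>) i)" by (rule psize_eq_sum)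
    also have "\<dots> = lo 0 + n + (\<Sum>i<N. hi i + lo (Suc i) - \<kappa> i)"
      by (subst sum.lessThan_Suc_shift) (simp add: \<beta>_def)
    finally have "psize (\<beta> (n, \<kappa>)) + psize \<kappa> =
        lo 0 + n + (\<Sum>i<N. (hi i + lo (Suc i) - \<kappa> i) + \<kappa> i)"
      using \<kappa>0 by (simp add: psize_eq_sum[of N] sum.distrib)
    also have "(\<Sum>i<N. (hi i + lo (Suc i) - \<kappa> i) + \<kappa> i) = (\<Sum>i<N. hi i + lo (Suc i))"
      using \<kappa>(2) by (intro sum.cong) (simp_all add: trans_le_add1)
    also have "lo 0 + n + \<dots> = n + (\<Sum>i<N. hi i) + (\<Sum>i<Suc N. lo i)"
      by (subst sum.lessThan_Suc_shift) (simp add: sum.distrib)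
    also have "\<dots> = n + (\<Sum>i<N. hi i + lo i)"
      using N by (simp add: sum.distrib lo_def)
    also have "(\<Sum>i<N. hi i + lo i) = (\<Sum>i<N. \<mu> i + \<nu> i)"
      by (rule sum.cong) (auto simp: hi_def lo_def)
    also have "\<dots> = psize \<mu> + psize \<nu>"
      using N by (simp add: psize_eq_sum[of N] sum.distrib)
    finally show ?thesis by simp
  qed
  have summand: "?F (\<beta> (n, \<kappa>)) = (u * y) ^ n * ?G \<kappa>" if "\<kappa> \<in> ?K" for n \<kappa>
  proof -
    have "psize \<kappa> \<le> psize \<mu>" "psize \<kappa> \<le> psize \<nu>"
      using that assms by (auto intro!: psize_mono simp: hstrip_def)
    then have "psize (\<beta> (n, \<kappa>)) - psize \<mu> = n + (psize \<nu> - psize \<kappa>)"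
      "psize (\<beta> (n, \<kappa>)) - psize \<nu> = n + (psize \<mu> - psize \<kappa>)"
      using size[OF that, of n] by linarith+
    then show ?thesis by (simp add: power_add power_mult_distrib algebra_simps)
  qed
  have finK: "finite ?K"
  proof (rule finite_subset)
    show "?K \<subseteq> {\<kappa> \<in> parts. psize \<kappa> \<le> psize \<mu>}"
      using assms by (auto intro!: psize_mono simp: hstrip_def)
  qed (rule finite_parts_psize_le)
  have uy: "(u * y) $ 0 = 0" using assms by simp
  have "fsum ?F ?L = fsum (\<lambda>a. ?F (\<beta> a)) (UNIV \<times> ?K)"
    by (rule fsum_reindex[OF bij, symmetric])
  also have "\<dots> = fsum (\<lambda>(n, \<kappa>). (u * y) ^ n * ?G \<kappa>) (UNIV \<times> ?K)"
    by (rule fsum_cong) (use summand in auto)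
  also have "\<dots> = fsum (\<lambda>n. (u * y) ^ n * fsum ?G ?K) UNIV"
    by (rule fsum_Sigma_mult[symmetric]) (auto intro: loc_fin_powers[OF uy] loc_fin_finite[OF finK])
  also have "\<dots> = fsum (\<lambda>n. (u * y) ^ n) UNIV * fsum ?G ?K"
    using fsum_cmult[OF loc_fin_powers[OF uy], of "fsum ?G ?K"] by (simp add: mult.commute)
  finally show ?thesis by (simp only: fps_inv1_geometric[OF uy])
qed

lemma Cauchy_kernel_vv:
  fixes u y :: "'a::comm_ring_1 fps"
  assumes "\<mu> \<in> parts" "\<nu> \<in> parts" "u $ 0 = 0"
  shows "fsum (\<lambda>l. u ^ (psize l - psize \<mu>) * y ^ (psize l - psize \<nu>))
           {l \<in> parts. vstrip \<mu> l \<and> vstrip \<nu> l} =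
         fps_inv1 (1 - u * y) *
         fsum (\<lambda>\<kappa>. u ^ (psize \<nu> - psize \<kappa>) * y ^ (psize \<mu> - psize \<kappa>))
           {\<kappa> \<in> parts. vstrip \<kappa> \<mu> \<and> vstrip \<kappa> \<nu>}"
proof -
  have bij: "bij_betw conj_part {f \<in> parts. P f} {f \<in> parts. Q f}"
    if "\<And>f. f \<in> parts \<Longrightarrow> Q (conj_part f) \<longleftrightarrow> P f" for P Q
    by (rule bij_betw_byWitness[where f' = conj_part])
      (use that in \<open>auto simp: conj_part_conj_part conj_part_in_parts\<close>,
        metis that conj_part_conj_part conj_part_in_parts)
  have "fsum (\<lambda>l. u ^ (psize l - psize \<mu>) * y ^ (psize l - psize \<nu>))
           {l \<in> parts. vstrip \<mu> l \<and> vstrip \<nu> l} =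
    fsum (\<lambda>l. (\<lambda>l. u ^ (psize l - psize (conj_part \<mu>)) * y ^ (psize l - psize (conj_part \<nu>))) (conj_part l))
           {l \<in> parts. vstrip \<mu> l \<and> vstrip \<nu> l}"
    by (rule fsum_cong) (use assms in \<open>auto simp: psize_conj_part\<close>)
  also have "\<dots> = fsum (\<lambda>l. u ^ (psize l - psize (conj_part \<mu>)) * y ^ (psize l - psize (conj_part \<nu>)))
      {l \<in> parts. hstrip (conj_part \<mu>) l \<and> hstrip (conj_part \<nu>) l}"
    by (rule fsum_reindex, rule bij) (use assms in \<open>auto simp: hstrip_conj_part\<close>)
  also have "\<dots> = fps_inv1 (1 - u * y) *
         fsum (\<lambda>\<kappa>. u ^ (psize (conj_part \<nu>) - psize \<kappa>) * y ^ (psize (conj_part \<mu>) - psize \<kappa>))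
           {\<kappa> \<in> parts. hstrip \<kappa> (conj_part \<mu>) \<and> hstrip \<kappa> (conj_part \<nu>)}"
    by (rule Cauchy_kernel_hh) (use assms in \<open>auto simp: conj_part_in_parts\<close>)
  also have "fsum (\<lambda>\<kappa>. u ^ (psize (conj_part \<nu>) - psize \<kappa>) * y ^ (psize (conj_part \<mu>) - psize \<kappa>))
           {\<kappa> \<in> parts. hstrip \<kappa> (conj_part \<mu>) \<and> hstrip \<kappa> (conj_part \<nu>)} =
       fsum (\<lambda>\<kappa>. (\<lambda>\<kappa>. u ^ (psize (conj_part \<nu>) - psize \<kappa>) * y ^ (psize (conj_part \<mu>) - psize \<kappa>)) (conj_part \<kappa>))
           {\<kappa> \<in> parts. vstrip \<kappa> \<mu> \<and> vstrip \<kappa> \<nu>}"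
    by (rule fsum_reindex[symmetric], rule bij) (use assms in \<open>auto simp: hstrip_conj_part\<close>)
  also have "\<dots> = fsum (\<lambda>\<kappa>. u ^ (psize \<nu> - psize \<kappa>) * y ^ (psize \<mu> - psize \<kappa>))
           {\<kappa> \<in> parts. vstrip \<kappa> \<mu> \<and> vstrip \<kappa> \<nu>}"
    by (rule fsum_cong) (use assms in \<open>auto simp: psize_conj_part\<close>)
  finally show ?thesis .
qed

lemma sum_box_functions:
  fixes w :: "nat \<Rightarrow> nat \<Rightarrow> 'a::comm_semiring_1" and n :: nat
  assumes "\<And>i. finite (I i)"
  defines "S \<equiv> {f. (\<forall>i\<le>n. f i \<in> I i) \<and> (\<forall>i>n. f i = 0)}"
  shows "finite S" and "(\<Sum>f\<in>S. \<Prod>i\<le>n. w i (f i)) = (\<Prod>i\<le>n. \<Sum>k\<in>I i. w i k)"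
proof -
  have bij: "bij_betw (\<lambda>f i. if i \<le> n then f i else 0) (PiE {..n} I) S"
    by (rule bij_betw_byWitness[where f' = "\<lambda>f. restrict f {..n}"])
      (auto simp: S_def PiE_def extensional_def fun_eq_iff)
  moreover have "finite (PiE {..n} I)" using assms(1) by (intro finite_PiE) auto
  ultimately show "finite S" using bij_betw_finite by blast
  have "(\<Sum>f\<in>S. \<Prod>i\<le>n. w i (f i)) =
      (\<Sum>f\<in>PiE {..n} I. \<Prod>i\<le>n. w i (if i \<le> n then f i else 0))"
    by (rule sum.reindex_bij_betw[OF bij, symmetric])
  also have "\<dots> = (\<Sum>f\<in>PiE {..n} I. \<Prod>i\<le>n. w i (f i))"
    by (intro sum.cong prod.cong) auto
  also have "\<dots> = (\<Prod>i\<le>n. \<Sum>k\<in>I i. w i k)"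
    using assms(1) by (subst prod_sum_PiE) auto
  finally show "(\<Sum>f\<in>S. \<Prod>i\<le>n. w i (f i)) = (\<Prod>i\<le>n. \<Sum>k\<in>I i. w i k)" .
qed

lemma row_sum_above:
  fixes u y :: "'a::comm_ring_1"
  assumes "m \<le> Suc v" "v \<le> p" "m \<le> p"
  shows "(\<Sum>k\<in>{max m v..min p (Suc v)}. u ^ (k - m) * y ^ (k - v)) =
    u ^ (v - m) * y ^ (m - v) * (if m \<le> v \<and> v < p then 1 + u * y else 1)"
proof (cases "m \<le> v \<and> v < p")
  case True
  then have "{max m v..min p (Suc v)} = {v, Suc v}" by auto
  with True show ?thesis by (simp add: Suc_diff_le algebra_simps)
next
  case False
  then have single: "{max m v..min p (Suc v)} = {max m v}" using assms by auto
  show ?thesis unfolding single using False by (cases "m \<le> v") simp_all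
qed

lemma row_sum_below:
  fixes u y :: "'a::comm_ring_1"
  assumes "m \<le> Suc v" "w \<le> m" "w \<le> v"
  shows "(\<Sum>k\<in>{max (m - 1) w..min m v}. u ^ (v - k) * y ^ (m - k)) =
    u ^ (v - m) * y ^ (m - v) * (if m \<le> v \<and> w < m then 1 + u * y else 1)"
proof (cases "m \<le> v \<and> w < m")
  case True
  then obtain m' where m: "m = Suc m'" by (cases m) auto
  with True have "{max (m - 1) w..min m v} = {m', Suc m'}" by auto
  moreover have "v - m' = Suc (v - m)" using True m by linarith
  ultimately show ?thesis using True m by (simp add: algebra_simps)
next
  case False
  then have single: "{max (m - 1) w..min m v} = {min m v}" using assms by auto
  show ?thesis unfolding single using False by (cases "m \<le> v") simp_all
qed

lemma Cauchy_kernel_hv: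
  fixes u y :: "'a::comm_ring_1 fps"
  assumes "\<mu> \<in> parts" "\<nu> \<in> parts"
  shows "fsum (\<lambda>l. u ^ (psize l - psize \<mu>) * y ^ (psize l - psize \<nu>))
           {l \<in> parts. hstrip \<mu> l \<and> vstrip \<nu> l} =
         (1 + u * y) *
         fsum (\<lambda>\<kappa>. u ^ (psize \<nu> - psize \<kappa>) * y ^ (psize \<mu> - psize \<kappa>))
           {\<kappa> \<in> parts. vstrip \<kappa> \<mu> \<and> hstrip \<kappa> \<nu>}"
    (is "fsum ?F ?L = _ * fsum ?G ?K")
proof (cases "\<forall>i. \<mu> i \<le> Suc (\<nu> i) \<and> \<nu> (Suc i) \<le> \<mu> i")
  case False
  have "\<mu> i \<le> Suc (\<nu> i) \<and> \<nu> (Suc i) \<le> \<mu> i" if "l \<in> ?L" for l i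
    using that unfolding hstrip_def vstrip_def by (auto intro: order_trans)
  moreover have "\<mu> i \<le> Suc (\<nu> i) \<and> \<nu> (Suc i) \<le> \<mu> i" if "l \<in> ?K" for l i
    using that unfolding hstrip_def vstrip_def by (auto intro: order_trans)
  ultimately have "?L = {}" "?K = {}" using False by blast+
  then show ?thesis by (simp only: fsum_finite[OF finite.emptyI]) simp
next
  case True
  then have compat: "\<mu> i \<le> Suc (\<nu> i)" "\<nu> (Suc i) \<le> \<mu> i" for i by auto
  obtain n where n: "\<And>i. n \<le> i \<Longrightarrow> \<mu> i = 0" "\<And>i. n \<le> i \<Longrightarrow> \<nu> i = 0"
    using common_vanishing_bound[OF assms] by blast
  have anti: "\<mu> (Suc i) \<le> \<mu> i" "\<nu> (Suc i) \<le> \<nu> i" for i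
    using assms by (auto simp: parts_def antimono_def)
  define p where "p i = (case i of 0 \<Rightarrow> Suc (\<nu> 0) | Suc k \<Rightarrow> \<mu> k)" for i
  define I where "I i = {max (\<mu> i) (\<nu> i)..min (p i) (Suc (\<nu> i))}" for i
  define J where "J i = {max (\<mu> i - 1) (\<nu> (Suc i))..min (\<mu> i) (\<nu> i)}" for i
  have L: "?L = {f. (\<forall>i\<le>n. f i \<in> I i) \<and> (\<forall>i>n. f i = 0)}"
  proof (intro equalityI subsetI)
    fix f assume "f \<in> ?L"
    then have f: "\<mu> i \<le> f i" "f (Suc i) \<le> \<mu> i" "\<nu> i \<le> f i" "f i \<le> Suc (\<nu> i)" for i
      by (auto simp: hstrip_def vstrip_def)
    have "f i = 0" if "i > n" for i
      using that f(2)[of "i - 1"] n(1)[of "i - 1"] by (cases i) auto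
    moreover have "f i \<in> I i" for i
      using f f(2)[of "i - 1"] by (cases i) (auto simp: I_def p_def)
    ultimately show "f \<in> {f. (\<forall>i\<le>n. f i \<in> I i) \<and> (\<forall>i>n. f i = 0)}" by blast
  next
    fix f assume f: "f \<in> {f. (\<forall>i\<le>n. f i \<in> I i) \<and> (\<forall>i>n. f i = 0)}"
    have "max (\<mu> i) (\<nu> i) \<le> f i \<and> f i \<le> min (p i) (Suc (\<nu> i))" for i
      using f n[of i] by (cases "i \<le> n") (auto simp: I_def)
    moreover from this have "f (Suc i) \<le> \<mu> i" for i
      by (metis min.boundedE old.nat.simps(5) p_def)
    ultimately have "hstrip \<mu> f" "vstrip \<nu> f"
      by (auto simp: hstrip_def vstrip_def)
    then show "f \<in> ?L" using assms(1) hstrip_parts by blast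
  qed
  have K: "?K = {f. (\<forall>i\<le>n. f i \<in> J i) \<and> (\<forall>i>n. f i = 0)}"
  proof (intro equalityI subsetI)
    fix f assume "f \<in> ?K"
    then have f: "f i \<le> \<mu> i" "\<mu> i \<le> Suc (f i)" "f i \<le> \<nu> i" "\<nu> (Suc i) \<le> f i" for i
      by (auto simp: hstrip_def vstrip_def)
    have "f i = 0" if "i > n" for i
      using that f(1)[of i] n(1)[of i] by auto
    moreover have "f i \<in> J i" for i
      using f[of i] by (auto simp: J_def)
    ultimately show "f \<in> {f. (\<forall>i\<le>n. f i \<in> J i) \<and> (\<forall>i>n. f i = 0)}" by blast
  next
    fix f assume f: "f \<in> {f. (\<forall>i\<le>n. f i \<in> J i) \<and> (\<forall>i>n. f i = 0)}"
    have "max (\<mu> i - 1) (\<nu> (Suc i)) \<le> f i \<and> f i \<le> min (\<mu> i) (\<nu> i)" for i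
      using f n[of i] n[of "Suc i"] by (cases "i \<le> n") (auto simp: J_def)
    then have "hstrip f \<nu>" "vstrip f \<mu>"
      by (simp_all add: hstrip_def vstrip_def le_diff_conv)
    then show "f \<in> ?K" using assms(2) hstrip_parts by blast
  qed
  have split: "x ^ (psize f - psize g) = (\<Prod>i\<le>n. x ^ (f i - g i))"
    if "\<And>i. g i \<le> f i" "\<And>i. n < i \<Longrightarrow> f i = 0" for x :: "'a fps" and f g
  proof -
    have "g i = 0" if "n < i" for i
      using \<open>g i \<le> f i\<close> \<open>\<And>i. n < i \<Longrightarrow> f i = 0\<close>[OF that] by simp
    then have "psize f - psize g = (\<Sum>i\<le>n. f i) - (\<Sum>i\<le>n. g i)"
      using that(2) by (simp add: psize_eq_sum[of "Suc n"] lessThan_Suc_atMost)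
    also have "\<dots> = (\<Sum>i\<le>n. f i - g i)"
      by (rule sum_subtractf_nat[symmetric]) (use that in auto)
    finally show ?thesis by (simp add: power_sum)
  qed
  define A where "A i = (\<Sum>k\<in>I i. u ^ (k - \<mu> i) * y ^ (k - \<nu> i))" for i
  define B where "B i = (\<Sum>k\<in>J i. u ^ (\<nu> i - k) * y ^ (\<mu> i - k))" for i
  have fin: "finite ?L" "finite ?K"
    unfolding L K by (rule sum_box_functions; simp add: I_def J_def)+
  have "fsum ?F ?L = (\<Sum>f\<in>?L. \<Prod>i\<le>n. u ^ (f i - \<mu> i) * y ^ (f i - \<nu> i))"
    unfolding fsum_finite[OF fin(1)] prod.distrib
    by (intro sum.cong refl arg_cong2[of _ _ _ _ "(*)"] split)
      (use L in \<open>auto simp: hstrip_def vstrip_def\<close>)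
  also have "\<dots> = (\<Prod>i\<le>n. A i)"
    unfolding L A_def by (rule sum_box_functions) (simp add: I_def)
  finally have sumL: "fsum ?F ?L = (\<Prod>i\<le>n. A i)" .
  have "fsum ?G ?K = (\<Sum>f\<in>?K. \<Prod>i\<le>n. u ^ (\<nu> i - f i) * y ^ (\<mu> i - f i))"
    unfolding fsum_finite[OF fin(2)] prod.distrib
    by (intro sum.cong refl arg_cong2[of _ _ _ _ "(*)"] split)
      (use n in \<open>auto simp: hstrip_def vstrip_def\<close>)
  also have "\<dots> = (\<Prod>i\<le>n. B i)"
    unfolding K B_def by (rule sum_box_functions) (simp add: J_def)
  finally have sumK: "fsum ?G ?K = (\<Prod>i\<le>n. B i)" .
  \<comment> \<open>Row by row the two sums agree only up to the gauge factors \<open>g\<close>, which telescope.\<close>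
  define g where "g i = (if \<nu> i < p i then 1 + u * y else 1)" for i
  have p: "\<nu> i \<le> p i" "\<mu> i \<le> p i" for i
    using compat anti by (cases i; simp add: p_def)+
  have local: "A i * g (Suc i) = B i * g i" for i
  proof -
    have "A i = u ^ (\<nu> i - \<mu> i) * y ^ (\<mu> i - \<nu> i) * (if \<mu> i \<le> \<nu> i \<and> \<nu> i < p i then 1 + u * y else 1)"
      unfolding A_def I_def by (rule row_sum_above) (use compat p in auto)
    moreover have "B i = u ^ (\<nu> i - \<mu> i) * y ^ (\<mu> i - \<nu> i) * (if \<mu> i \<le> \<nu> i \<and> \<nu> (Suc i) < \<mu> i then 1 + u * y else 1)"
      unfolding B_def J_def by (rule row_sum_below) (use compat anti in auto)
    moreover have "\<nu> i < p i" "\<nu> (Suc i) < \<mu> i" if "\<not> \<mu> i \<le> \<nu> i"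
      using that p(2)[of i] anti(2)[of i] by linarith+
    moreover have "p (Suc i) = \<mu> i" by (simp add: p_def)
    ultimately show ?thesis by (auto simp: g_def)
  qed
  have "(\<Prod>i<m. A i) * g m = (1 + u * y) * (\<Prod>i<m. B i)" for m
  proof (induction m)
    case 0
    show ?case by (simp add: g_def p_def)
  next
    case (Suc m)
    have "(\<Prod>i<Suc m. A i) * g (Suc m) = (\<Prod>i<m. A i) * (A m * g (Suc m))"
      by (simp add: mult.assoc)
    also have "\<dots> = ((\<Prod>i<m. A i) * g m) * B m"
      unfolding local by (simp only: mult_ac)
    finally show ?case by (simp add: Suc.IH mult.assoc)
  qed
  from this[of "Suc n"] have "(\<Prod>i\<le>n. A i) = (1 + u * y) * (\<Prod>i\<le>n. B i)"
    using n by (simp add: g_def p_def lessThan_Suc_atMost)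
  then show ?thesis by (simp only: sumL sumK)
qed

section \<open>Vertex operators\<close>

definition strip :: "bool \<Rightarrow> (nat \<Rightarrow> nat) \<Rightarrow> (nat \<Rightarrow> nat) \<Rightarrow> bool" where
  "strip h = (if h then hstrip else vstrip)"

text \<open>
  The weights are attached to the size differences of consecutive partitions rather than to their
  sizes: only then do they travel with the operators when these are commuted. The flag \<open>h\<close> selects
  horizontal strips.
\<close>

definition up_op ::
    "bool \<Rightarrow> 'a::comm_ring_1 fps \<Rightarrow> ((nat \<Rightarrow> nat) \<Rightarrow> 'a fps) \<Rightarrow> (nat \<Rightarrow> nat) \<Rightarrow> 'a fps" where
  "up_op h u F \<mu> = fsum (\<lambda>l. u ^ (psize l - psize \<mu>) * F l) {l \<in> parts. strip h \<mu> l}"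

definition down_op ::
    "bool \<Rightarrow> 'a::comm_ring_1 fps \<Rightarrow> ((nat \<Rightarrow> nat) \<Rightarrow> 'a fps) \<Rightarrow> (nat \<Rightarrow> nat) \<Rightarrow> 'a fps" where
  "down_op h y F \<mu> = fsum (\<lambda>\<kappa>. y ^ (psize \<mu> - psize \<kappa>) * F \<kappa>) {\<kappa> \<in> parts. strip h \<kappa> \<mu>}"

definition vac :: "(nat \<Rightarrow> nat) \<Rightarrow> 'a::comm_ring_1 fps" where
  "vac \<mu> = (if \<mu> = (\<lambda>_. 0) then 1 else 0)"

definition comm_factor :: "bool \<Rightarrow> 'a::comm_ring_1 fps \<Rightarrow> 'a fps" where
  "comm_factor same x = (if same then fps_inv1 (1 - x) else 1 + x)"

lemma strip_le: "strip h g f \<Longrightarrow> g i \<le> f i"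
  by (cases h) (simp_all add: strip_def hstrip_def vstrip_def)

lemma strip_refl_zero: "strip h (\<lambda>_. 0) (\<lambda>_. 0)"
  by (simp add: strip_def hstrip_def vstrip_def)

lemma finite_strip_below:
  assumes "f \<in> parts"
  shows "finite {g \<in> parts. strip h g f}"
proof (rule finite_subset[OF _ finite_parts_psize_le[of "psize f"]])
  show "{g \<in> parts. strip h g f} \<subseteq> {g \<in> parts. psize g \<le> psize f}"
    using psize_mono[OF assms] strip_le by blast
qed

lemma loc_fin_strip_above:
  assumes "(u :: 'a::comm_ring_1 fps) $ 0 = 0"
  shows "loc_fin (\<lambda>l. u ^ (psize l - psize \<mu>) * F l) {l \<in> parts. strip h \<mu> l}"
proof (rule loc_fin_mult, unfold loc_fin_def, rule)
  fix i
  have "{l \<in> {l \<in> parts. strip h \<mu> l}. u ^ (psize l - psize \<mu>) $ i \<noteq> 0}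
      \<subseteq> {l \<in> parts. psize l \<le> psize \<mu> + i}"
  proof clarify
    fix l assume "u ^ (psize l - psize \<mu>) $ i \<noteq> 0"
    then have "psize l - psize \<mu> \<le> i"
      using assms by (metis fps_power_nth_eq_0 not_le)
    then show "psize l \<le> psize \<mu> + i" by simp
  qed
  then show "finite {l \<in> {l \<in> parts. strip h \<mu> l}. u ^ (psize l - psize \<mu>) $ i \<noteq> 0}"
    by (rule finite_subset) (rule finite_parts_psize_le)
qed

lemma Cauchy_kernel:
  fixes u y :: "'a::comm_ring_1 fps"
  assumes "\<mu> \<in> parts" "\<nu> \<in> parts" "u $ 0 = 0"
  shows "fsum (\<lambda>l. u ^ (psize l - psize \<mu>) * y ^ (psize l - psize \<nu>))
           {l \<in> parts. strip h \<mu> l \<and> strip h' \<nu> l} =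
         comm_factor (h = h') (u * y) *
         fsum (\<lambda>\<kappa>. u ^ (psize \<nu> - psize \<kappa>) * y ^ (psize \<mu> - psize \<kappa>))
           {\<kappa> \<in> parts. strip h' \<kappa> \<mu> \<and> strip h \<kappa> \<nu>}"
proof (cases h; cases h')
  assume "\<not> h" "h'"
  then show ?thesis
    using Cauchy_kernel_hv[OF assms(2,1), of y u]
    by (simp add: strip_def comm_factor_def mult.commute conj_commute)
qed (use Cauchy_kernel_hh[OF assms, of y] Cauchy_kernel_vv[OF assms, of y]
      Cauchy_kernel_hv[OF assms(1,2), of u y] in \<open>simp_all add: strip_def comm_factor_def\<close>)

lemma up_down_commute:
  fixes u y :: "'a::comm_ring_1 fps"
  assumes "\<mu> \<in> parts" "u $ 0 = 0"
  shows "up_op h u (down_op h' y F) \<mu> =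
    comm_factor (h = h') (u * y) * down_op h' y (up_op h u F) \<mu>"
proof -
  let ?c = "comm_factor (h = h') (u * y)"
  let ?L = "\<lambda>\<nu>. {l \<in> parts. strip h \<mu> l \<and> strip h' \<nu> l}"
  let ?K = "\<lambda>\<nu>. {\<kappa> \<in> parts. strip h' \<kappa> \<mu> \<and> strip h \<kappa> \<nu>}"
  have locU: "loc_fin (\<lambda>l. u ^ (psize l - psize \<mu>)) {l \<in> parts. strip h \<mu> l}" for \<mu>
    using loc_fin_strip_above[OF assms(2), of \<mu> "\<lambda>_. 1"] by simp
  have locD: "loc_fin f {\<kappa> \<in> parts. strip h' \<kappa> \<mu>}" if "\<mu> \<in> parts" for \<mu> and f :: "_ \<Rightarrow> 'a fps"
    by (rule loc_fin_finite) (rule finite_strip_below[OF that])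
  have locK: "loc_fin (\<lambda>(\<kappa>, \<nu>). y ^ (psize \<mu> - psize \<kappa>) * (u ^ (psize \<nu> - psize \<kappa>) * F \<nu>))
      (SIGMA \<kappa>:{\<kappa> \<in> parts. strip h' \<kappa> \<mu>}. {\<nu> \<in> parts. strip h \<kappa> \<nu>})"
    by (rule loc_fin_Sigma_mult) (auto intro: locD[OF assms(1)] loc_fin_strip_above[OF assms(2)])
  have kerL: "fsum (\<lambda>l. u ^ (psize l - psize \<mu>) * (y ^ (psize l - psize \<nu>) * F \<nu>)) (?L \<nu>) =
      F \<nu> * fsum (\<lambda>l. u ^ (psize l - psize \<mu>) * y ^ (psize l - psize \<nu>)) (?L \<nu>)" for \<nu>
  proof -
    have "loc_fin (\<lambda>l. u ^ (psize l - psize \<mu>) * y ^ (psize l - psize \<nu>)) (?L \<nu>)"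
      by (rule loc_fin_subset[OF loc_fin_strip_above[OF assms(2)]]) auto
    from fsum_cmult[OF this, of "F \<nu>"] show ?thesis by (simp only: mult_ac)
  qed
  have kerK: "fsum (\<lambda>\<kappa>. ?c * (y ^ (psize \<mu> - psize \<kappa>) * (u ^ (psize \<nu> - psize \<kappa>) * F \<nu>))) (?K \<nu>) =
      F \<nu> * (?c * fsum (\<lambda>\<kappa>. u ^ (psize \<nu> - psize \<kappa>) * y ^ (psize \<mu> - psize \<kappa>)) (?K \<nu>))" for \<nu>
  proof -
    have "loc_fin (\<lambda>\<kappa>. u ^ (psize \<nu> - psize \<kappa>) * y ^ (psize \<mu> - psize \<kappa>)) (?K \<nu>)"
      by (rule loc_fin_subset[OF locD[OF assms(1)]]) auto
    from fsum_cmult[OF this, of "F \<nu> * ?c"] show ?thesis by (simp only: mult_ac)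
  qed
  have "up_op h u (down_op h' y F) \<mu> =
      fsum (\<lambda>(l, \<nu>). u ^ (psize l - psize \<mu>) * (y ^ (psize l - psize \<nu>) * F \<nu>))
        (SIGMA l:{l \<in> parts. strip h \<mu> l}. {\<nu> \<in> parts. strip h' \<nu> l})"
    unfolding up_op_def down_op_def
    by (rule fsum_Sigma_mult) (auto intro: locU locD)
  also have "\<dots> = fsum (\<lambda>\<nu>. fsum (\<lambda>l. u ^ (psize l - psize \<mu>) * (y ^ (psize l - psize \<nu>) * F \<nu>)) (?L \<nu>)) parts"
    by (rule fsum_Sigma_swap, rule loc_fin_Sigma_mult) (auto intro: locU locD)
  also have "\<dots> = fsum (\<lambda>\<nu>. fsum (\<lambda>\<kappa>. ?c * (y ^ (psize \<mu> - psize \<kappa>) * (u ^ (psize \<nu> - psize \<kappa>) * F \<nu>))) (?K \<nu>)) parts"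
    unfolding kerL kerK
    by (intro fsum_cong refl arg_cong[of _ _ "(*) (F _)"] Cauchy_kernel assms)
  also have "\<dots> = fsum (\<lambda>(\<kappa>, \<nu>). ?c * (y ^ (psize \<mu> - psize \<kappa>) * (u ^ (psize \<nu> - psize \<kappa>) * F \<nu>)))
        (SIGMA \<kappa>:{\<kappa> \<in> parts. strip h' \<kappa> \<mu>}. {\<nu> \<in> parts. strip h \<kappa> \<nu>})"
    by (rule fsum_Sigma_swap[symmetric])
      (use loc_fin_cmult[OF locK, of ?c] in \<open>simp only: case_prod_unfold\<close>, blast)
  also have "\<dots> = ?c * fsum (\<lambda>(\<kappa>, \<nu>). y ^ (psize \<mu> - psize \<kappa>) * (u ^ (psize \<nu> - psize \<kappa>) * F \<nu>))
        (SIGMA \<kappa>:{\<kappa> \<in> parts. strip h' \<kappa> \<mu>}. {\<nu> \<in> parts. strip h \<kappa> \<nu>})"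
    using fsum_cmult[OF locK, of ?c] by (simp only: case_prod_unfold)
  also have "fsum (\<lambda>(\<kappa>, \<nu>). y ^ (psize \<mu> - psize \<kappa>) * (u ^ (psize \<nu> - psize \<kappa>) * F \<nu>))
        (SIGMA \<kappa>:{\<kappa> \<in> parts. strip h' \<kappa> \<mu>}. {\<nu> \<in> parts. strip h \<kappa> \<nu>}) =
      down_op h' y (up_op h u F) \<mu>"
    unfolding up_op_def down_op_def
    by (rule fsum_Sigma_mult[symmetric]) (auto intro: locD[OF assms(1)] loc_fin_strip_above[OF assms(2)])
  finally show ?thesis .
qed

lemma up_op_cmult:
  assumes "u $ 0 = 0" "\<And>l. l \<in> parts \<Longrightarrow> F l = c * G l"
  shows "up_op h u F \<mu> = c * up_op h u G \<mu>"
  unfolding up_op_def fsum_cmult[OF loc_fin_strip_above[OF assms(1)], symmetric]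
  by (rule fsum_cong) (simp_all add: assms(2) mult.left_commute)

lemma down_op_cmult:
  assumes "\<mu> \<in> parts" "\<And>l. l \<in> parts \<Longrightarrow> F l = c * G l"
  shows "down_op h y F \<mu> = c * down_op h y G \<mu>"
  unfolding down_op_def fsum_cmult[OF loc_fin_finite[OF finite_strip_below[OF assms(1)]], symmetric]
  by (rule fsum_cong) (simp_all add: assms(2) mult.left_commute)

lemma up_op_vac:
  assumes "\<mu> \<in> parts"
  shows "up_op h u vac \<mu> = vac \<mu>"
proof -
  have "up_op h u vac \<mu> = fsum (\<lambda>l. if l = (\<lambda>_. 0) then u ^ (psize l - psize \<mu>) else 0) {l \<in> parts. strip h \<mu> l}"
    unfolding up_op_def vac_def by (rule fsum_cong) auto
  also have "\<dots> = vac \<mu>"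
  proof (rule fps_ext)
    fix i
    let ?f = "\<lambda>l. if l = (\<lambda>_. 0) then u ^ (psize l - psize \<mu>) else 0"
    let ?B = "{l \<in> {\<lambda>_. 0}. strip h \<mu> l}"
    have "fsum ?f {l \<in> parts. strip h \<mu> l} $ i = (\<Sum>l\<in>?B. ?f l $ i)"
      by (rule fsum_nth) (auto simp: zero_in_parts)
    also have "\<dots> = vac \<mu> $ i"
    proof (cases "\<mu> = (\<lambda>_. 0)")
      case True
      then have B: "?B = {\<lambda>_. 0}" using strip_refl_zero by auto
      show ?thesis unfolding B using True by (simp add: vac_def)
    next
      case False
      then have "\<not> strip h \<mu> (\<lambda>_. 0)" using strip_le by (metis le_zero_eq ext)
      then have B: "?B = {}" by blast
      show ?thesis unfolding B using False by (simp add: vac_def)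
    qed
    finally show "fsum ?f {l \<in> parts. strip h \<mu> l} $ i = vac \<mu> $ i" .
  qed
  finally show ?thesis .
qed

definition down_chain :: "(bool \<times> 'a::comm_ring_1 fps) list \<Rightarrow> (nat \<Rightarrow> nat) \<Rightarrow> 'a fps" where
  "down_chain ds = foldr (\<lambda>(h, y). down_op h y) ds vac"

lemma down_chain_simps:
  "down_chain [] = vac" "down_chain ((h, y) # ds) = down_op h y (down_chain ds)"
  by (simp_all add: down_chain_def)

lemma up_op_down_chain:
  assumes "u $ 0 = 0" "\<mu> \<in> parts"
  shows "up_op h u (down_chain ds) \<mu> =
    (\<Prod>(h', y)\<leftarrow>ds. comm_factor (h = h') (u * y)) * down_chain ds \<mu>"
  using assms(2)
proof (induction ds arbitrary: \<mu>)
  case Nil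
  then show ?case by (simp add: down_chain_simps up_op_vac)
next
  case (Cons d ds)
  obtain h' y where d: "d = (h', y)" by (cases d)
  have "up_op h u (down_chain (d # ds)) \<mu> =
      comm_factor (h = h') (u * y) * down_op h' y (up_op h u (down_chain ds)) \<mu>"
    unfolding d down_chain_simps by (rule up_down_commute) fact+
  also have "down_op h' y (up_op h u (down_chain ds)) \<mu> =
      (\<Prod>(h', y)\<leftarrow>ds. comm_factor (h = h') (u * y)) * down_op h' y (down_chain ds) \<mu>"
    by (rule down_op_cmult) (use Cons in auto)
  finally show ?case by (simp add: d down_chain_simps mult.assoc)
qed

lemma up_chain_down_chain:
  assumes "\<And>h u. (h, u) \<in> set us \<Longrightarrow> u $ 0 = 0" "\<mu> \<in> parts"
  shows "foldr (\<lambda>(h, u). up_op h u) us (down_chain ds) \<mu> =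
    (\<Prod>(h, u)\<leftarrow>us. \<Prod>(h', y)\<leftarrow>ds. comm_factor (h = h') (u * y)) * down_chain ds \<mu>"
  using assms
proof (induction us arbitrary: \<mu>)
  case (Cons s us)
  obtain h u where s: "s = (h, u)" by (cases s)
  have u: "u $ 0 = 0" using Cons.prems s by auto
  let ?P = "\<Prod>(h, u)\<leftarrow>us. \<Prod>(h', y)\<leftarrow>ds. comm_factor (h = h') (u * y)"
  have "up_op h u (foldr (\<lambda>(h, u). up_op h u) us (down_chain ds)) \<mu> = ?P * up_op h u (down_chain ds) \<mu>"
    by (rule up_op_cmult[OF u]) (use Cons in auto)
  then show ?case
    using up_op_down_chain[OF u Cons.prems(2), of h ds] by (simp add: s mult_ac)
qed simp

lemma down_chain_zero: "down_chain ds (\<lambda>_. 0) = 1"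
proof (induction ds)
  case (Cons d ds)
  obtain h y where d: "d = (h, y)" by (cases d)
  have "{\<kappa> \<in> parts. strip h \<kappa> (\<lambda>_. 0)} = {\<lambda>_. 0}"
    using zero_in_parts strip_refl_zero strip_le by (auto simp: fun_eq_iff) (metis le_zero_eq)
  then show ?case
    by (simp add: d down_chain_simps down_op_def fsum_finite Cons.IH)
qed (simp add: down_chain_simps vac_def)

definition step_rel :: "bool \<Rightarrow> bool \<Rightarrow> (nat \<Rightarrow> nat) \<Rightarrow> (nat \<Rightarrow> nat) set" where
  "step_rel d h \<mu> = {l \<in> parts. if d then strip h \<mu> l else strip h l \<mu>}"

definition step_exp :: "bool \<Rightarrow> (nat \<Rightarrow> nat) \<Rightarrow> (nat \<Rightarrow> nat) \<Rightarrow> nat" where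
  "step_exp d \<mu> l = (if d then psize l - psize \<mu> else psize \<mu> - psize l)"

text \<open>
  In a step \<open>(d, h, w)\<close> the flag \<open>d\<close> tells up-steps from down-steps.
\<close>

fun paths :: "(bool \<times> bool \<times> 'a fps) list \<Rightarrow> (nat \<Rightarrow> nat) \<Rightarrow> (nat \<Rightarrow> nat) list set" where
  "paths [] \<mu> = (if \<mu> = (\<lambda>_. 0) then {[]} else {})"
| "paths ((d, h, w) # ss) \<mu> = (\<lambda>(l, ls). l # ls) ` Sigma (step_rel d h \<mu>) (paths ss)"

fun path_weight :: "(bool \<times> bool \<times> 'a::comm_ring_1 fps) list \<Rightarrow> (nat \<Rightarrow> nat) \<Rightarrow> (nat \<Rightarrow> nat) list \<Rightarrow> 'a fps" where
  "path_weight ((d, h, w) # ss) \<mu> (l # ls) = w ^ step_exp d \<mu> l * path_weight ss l ls"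
| "path_weight _ _ _ = 1"

lemma chain_eq_fsum_paths:
  assumes "\<And>h w. (True, h, w) \<in> set ss \<Longrightarrow> w $ 0 = 0" "\<mu> \<in> parts"
  shows "loc_fin (path_weight ss \<mu>) (paths ss \<mu>)"
    and "foldr (\<lambda>(d, h, w). if d then up_op h w else down_op h w) ss vac \<mu> =
      fsum (path_weight ss \<mu>) (paths ss \<mu>)"
proof -
  have "loc_fin (path_weight ss \<mu>) (paths ss \<mu>) \<and>
    foldr (\<lambda>(d, h, w). if d then up_op h w else down_op h w) ss vac \<mu> =
      fsum (path_weight ss \<mu>) (paths ss \<mu>)"
    using assms
  proof (induction ss arbitrary: \<mu>)
    case Nil
    then show ?case
      by (cases "\<mu> = (\<lambda>_. 0)") (simp_all add: vac_def loc_fin_finite fsum_finite)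
  next
    case (Cons s ss)
    obtain d h w where s: "s = (d, h, w)" by (cases s)
    let ?F = "foldr (\<lambda>(d, h, w). if d then up_op h w else down_op h w) ss vac"
    have IH: "loc_fin (path_weight ss l) (paths ss l)" "?F l = fsum (path_weight ss l) (paths ss l)"
      if "l \<in> step_rel d h \<mu>" for l
      using that Cons by (auto simp: step_rel_def)
    have bij: "bij_betw (\<lambda>(l, ls). l # ls) (Sigma (step_rel d h \<mu>) (paths ss)) (paths (s # ss) \<mu>)"
      by (auto simp: s bij_betw_def inj_on_def)
    have loc: "loc_fin (\<lambda>l. w ^ step_exp d \<mu> l) (step_rel d h \<mu>)"
    proof (cases d)
      case True
      then have "w $ 0 = 0" using Cons.prems(1) s by auto
      from loc_fin_strip_above[OF this, of \<mu> "\<lambda>_. 1" h] show ?thesis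
        using True by (simp add: step_rel_def step_exp_def)
    next
      case False
      then show ?thesis
        by (auto simp: step_rel_def intro!: loc_fin_finite finite_strip_below Cons.prems)
    qed
    have loc2: "loc_fin (\<lambda>(l, ls). w ^ step_exp d \<mu> l * path_weight ss l ls) (Sigma (step_rel d h \<mu>) (paths ss))"
      by (rule loc_fin_Sigma_mult[OF loc IH(1)])
    have "foldr (\<lambda>(d, h, w). if d then up_op h w else down_op h w) (s # ss) vac \<mu> =
        fsum (\<lambda>l. w ^ step_exp d \<mu> l * ?F l) (step_rel d h \<mu>)"
      by (cases d) (simp_all add: s up_op_def down_op_def step_exp_def step_rel_def)
    also have "\<dots> = fsum (\<lambda>l. w ^ step_exp d \<mu> l * fsum (path_weight ss l) (paths ss l)) (step_rel d h \<mu>)"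
      by (rule fsum_cong) (simp_all add: IH(2))
    also have "\<dots> = fsum (\<lambda>(l, ls). w ^ step_exp d \<mu> l * path_weight ss l ls) (Sigma (step_rel d h \<mu>) (paths ss))"
      by (rule fsum_Sigma_mult[OF loc IH(1)])
    also have "\<dots> = fsum (\<lambda>z. path_weight (s # ss) \<mu> ((\<lambda>(l, ls). l # ls) z)) (Sigma (step_rel d h \<mu>) (paths ss))"
      by (rule fsum_cong) (auto simp: s)
    also have "\<dots> = fsum (path_weight (s # ss) \<mu>) (paths (s # ss) \<mu>)"
      by (rule fsum_reindex[OF bij])
    finally have "foldr (\<lambda>(d, h, w). if d then up_op h w else down_op h w) (s # ss) vac \<mu> =
      fsum (path_weight (s # ss) \<mu>) (paths (s # ss) \<mu>)" .
    moreover have "loc_fin (path_weight (s # ss) \<mu>) (paths (s # ss) \<mu>)"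
      by (rule loc_fin_reindex[OF bij]) (use loc2 in \<open>simp add: s case_prod_unfold\<close>)
    ultimately show ?case by blast
  qed
  then show "loc_fin (path_weight ss \<mu>) (paths ss \<mu>)"
    and "foldr (\<lambda>(d, h, w). if d then up_op h w else down_op h w) ss vac \<mu> =
      fsum (path_weight ss \<mu>) (paths ss \<mu>)" by blast+
qed

section \<open>Slicing the pyramid\<close>

lemma mem_layer_1_iff:
  "(x, y) \<in> layer 1 k \<longleftrightarrow>
    \<bar>x\<bar> \<le> (int k + 1) div 2 \<and> \<bar>y\<bar> \<le> int k div 2 \<and>
    even (x - (int k + 1) div 2) \<and> even (y - int k div 2)"
proof (induction k arbitrary: x y)
  case 0
  show ?case by auto
next
  case (Suc k)
  have shift_plus: "z \<in> {p + d |p. p \<in> L} \<longleftrightarrow> z - d \<in> L" for z d :: "int \<times> int" and L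
  proof
    assume "z - d \<in> L"
    then show "z \<in> {p + d |p. p \<in> L}" by (intro CollectI exI[of _ "z - d"]) simp
  qed auto
  have shift_minus: "z \<in> {p - d |p. p \<in> L} \<longleftrightarrow> z + d \<in> L" for z d :: "int \<times> int" and L
  proof
    assume "z + d \<in> L"
    then show "z \<in> {p - d |p. p \<in> L}" by (intro CollectI exI[of _ "z + d"]) simp
  qed auto
  have parity: "(\<bar>x - 1\<bar> \<le> a \<and> even (x - 1 - a) \<or> \<bar>x + 1\<bar> \<le> a \<and> even (x + 1 - a)) \<longleftrightarrow>
      \<bar>x\<bar> \<le> a + 1 \<and> even (x - (a + 1))" if "0 \<le> a" for x a :: int
  proof (cases "even (x - (a + 1))")
    case True
    then obtain c where "x = a + 1 + 2 * c" by (metis add.commute diff_add_cancel evenE)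
    then show ?thesis using that by (auto simp: abs_le_iff)
  qed (use that in auto)
  have "(x, y) \<in> layer 1 (Suc k) \<longleftrightarrow> (x, y) - dir k \<in> layer 1 k \<or> (x, y) + dir k \<in> layer 1 k"
    unfolding layer.simps Un_iff shift_plus shift_minus ..
  also have "\<dots> \<longleftrightarrow> \<bar>x\<bar> \<le> (int (Suc k) + 1) div 2 \<and> \<bar>y\<bar> \<le> int (Suc k) div 2 \<and>
    even (x - (int (Suc k) + 1) div 2) \<and> even (y - int (Suc k) div 2)"
  proof (cases "even k")
    case True
    then obtain a where k: "k = 2 * a" by blast
    have divs: "(int k + 1) div 2 = int a" "int k div 2 = int a"
      "(int (Suc k) + 1) div 2 = int a + 1" "int (Suc k) div 2 = int a" by (simp_all add: k)
    show ?thesis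
      unfolding dir_def using True parity[of "int a" x, OF of_nat_0_le_iff]
      by (simp only: if_True diff_Pair add_Pair diff_0_right add_0_right Suc divs) blast
  next
    case False
    then obtain a where k: "k = 2 * a + 1" by (elim oddE)
    have divs: "(int k + 1) div 2 = int a + 1" "int k div 2 = int a"
      "(int (Suc k) + 1) div 2 = int a + 1" "int (Suc k) div 2 = int a + 1" by (simp_all add: k)
    show ?thesis
      unfolding dir_def using False parity[of "int a" y, OF of_nat_0_le_iff]
      by (simp only: if_False diff_Pair add_Pair diff_0_right add_0_right Suc divs) blast
  qed
  finally show ?case .
qed

text \<open>
  The slice \<open>x + y = t\<close> has its apex in layer \<open>\<bar>t\<bar>\<close>, at \<open>(apex_x t, t - apex_x t)\<close>; from there \<open>i\<close> and \<open>j\<close>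
  count double steps downwards in the directions \<open>(1, -1)\<close> and \<open>(-1, 1)\<close>.
\<close>

definition apex_x :: "int \<Rightarrow> int" where
  "apex_x t = (if t < 0 then t div 2 else (t + 1) div 2)"

definition slice_brick :: "int \<Rightarrow> nat \<Rightarrow> nat \<Rightarrow> brick" where
  "slice_brick t i j =
    (nat \<bar>t\<bar> + 2 * (i + j), apex_x t + int i - int j, t - apex_x t + int j - int i)"

lemma slice_brick_inject [simp]:
  "slice_brick t i j = slice_brick t' i' j' \<longleftrightarrow> t = t' \<and> i = i' \<and> j = j'"
proof
  assume eq: "slice_brick t i j = slice_brick t' i' j'"
  then have "t = t'" by (simp add: slice_brick_def)
  with eq show "t = t' \<and> i = i' \<and> j = j'" by (simp add: slice_brick_def)
qed auto

lemma even_fst_slice_brick [simp]: "even (fst (slice_brick t i j)) \<longleftrightarrow> even t"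
  by (simp add: slice_brick_def even_nat_iff)

lemma slice_brick_in_empty_room: "slice_brick t i j \<in> empty_room 1"
proof -
  define k where "k = nat \<bar>t\<bar> + 2 * (i + j)"
  define r where "r = t div 2"
  consider "t = 2 * r" "0 \<le> r" | "t = 2 * r" "r < 0" | "t = 2 * r + 1" "0 \<le> r" | "t = 2 * r + 1" "r < 0"
    unfolding r_def by linarith
  then have "(apex_x t + int i - int j, t - apex_x t + int j - int i) \<in> layer 1 k"
  proof cases
    case 1
    then have "apex_x t = r" "int k = 2 * (r + int i + int j)" by (simp_all add: k_def apex_x_def)
    then show ?thesis unfolding mem_layer_1_iff using 1 by (simp add: abs_le_iff)
  next
    case 2
    then have "apex_x t = r" "int k = 2 * (- r + int i + int j)" by (simp_all add: k_def apex_x_def)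
    then show ?thesis unfolding mem_layer_1_iff using 2 by (simp add: abs_le_iff)
  next
    case 3
    then have "apex_x t = r + 1" "int k = 2 * (r + int i + int j) + 1"
      by (simp_all add: k_def apex_x_def)
    then show ?thesis unfolding mem_layer_1_iff using 3 by (simp add: abs_le_iff)
  next
    case 4
    define m where "m = - r - 1 + int i + int j"
    have "apex_x t = r" "int k = 2 * m + 1"
      using 4 by (simp_all add: k_def apex_x_def m_def)
    then show ?thesis unfolding mem_layer_1_iff using 4 by (simp add: abs_le_iff) (auto simp: m_def)
  qed
  then show ?thesis by (simp add: slice_brick_def empty_room_def k_def)
qed

lemma empty_room_slice_brick:
  assumes "B \<in> empty_room 1"
  obtains t i j where "B = slice_brick t i j"
proof -
  obtain k x y where B: "B = (k, x, y)" by (cases B)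
  define hx hy where "hx = (int k + 1) div 2" and "hy = int k div 2"
  have k: "int k = hx + hy" unfolding hx_def hy_def by linarith
  have mem: "\<bar>x\<bar> \<le> hx" "\<bar>y\<bar> \<le> hy" "even (x - hx)" "even (y - hy)"
    using assms unfolding B empty_room_def mem_Collect_eq case_prod_conv mem_layer_1_iff hx_def hy_def
    by auto
  then obtain b c where "x - hx = 2 * b" "y - hy = 2 * c" by (elim evenE)
  then have xy: "x = hx + 2 * b" "y = hy + 2 * c" by linarith+
  have t: "x + y = int k + 2 * (b + c)" using xy k by simp
  show thesis
  proof (cases "0 \<le> x + y")
    case True
    have "apex_x (x + y) = hx + b + c"
      using True unfolding apex_x_def t hx_def by simp
    then have "B = slice_brick (x + y) (nat (- c)) (nat (- b))"
      using True mem xy k by (auto simp: B slice_brick_def)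
    then show thesis by (rule that)
  next
    case False
    have "apex_x (x + y) = hy + b + c"
      using False unfolding apex_x_def t hy_def by simp
    then have "B = slice_brick (x + y) (nat (hx + b)) (nat (hy + c))"
      using False mem xy k by (auto simp: B slice_brick_def)
    then show thesis by (rule that)
  qed
qed

lemma rests_upon_slice_brick_iff:
  "rests_upon (slice_brick t i j) (slice_brick t' i' j') \<longleftrightarrow>
    (t' = t + 1 \<and> (if t \<ge> 0 then i' = i \<and> j' = j
                 else if odd t then i' = i \<and> j' = Suc j else i' = Suc i \<and> j' = j)) \<or>
    (t' = t - 1 \<and> (if t \<le> 0 then i' = i \<and> j' = j
                 else if odd t then i' = Suc i \<and> j' = j else i' = i \<and> j' = Suc j))"
proof -
  have "rests_upon (slice_brick t i j) B \<longleftrightarrow>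
    B = slice_brick (t + 1) (if t \<ge> 0 \<or> odd t then i else Suc i) (if t \<ge> 0 \<or> even t then j else Suc j) \<or>
    B = slice_brick (t - 1) (if t \<le> 0 \<or> even t then i else Suc i) (if t \<le> 0 \<or> odd t then j else Suc j)" for B
  proof (cases "even t")
    case True
    then obtain r where "t = 2 * r" by blast
    then show ?thesis
      by (cases B) (auto simp: rests_upon_def slice_brick_def dir_def even_nat_iff apex_x_def)
  next
    case False
    then obtain r where "t = 2 * r + 1" by (elim oddE)
    then show ?thesis
      by (cases B) (auto simp: rests_upon_def slice_brick_def dir_def even_nat_iff apex_x_def; presburger)
  qed
  then show ?thesis
    unfolding slice_brick_inject by (cases "0 \<le> t"; cases "t \<le> 0"; cases "even t"; simp)
qed

lemma finite_cells:
  assumes "f \<in> parts"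
  shows "finite {(i, j). j < f i}"
proof -
  obtain n where n: "\<And>i. n \<le> i \<Longrightarrow> f i = 0" using assms by (auto simp: parts_def)
  have "{(i, j). j < f i} = Sigma {..<n} (\<lambda>i. {..<f i})"
    using n by (auto simp: not_le[symmetric])
  then show ?thesis by simp
qed

definition slice_seqs :: "nat \<Rightarrow> (int \<Rightarrow> nat \<Rightarrow> nat) set" where
  "slice_seqs M = {L. (\<forall>t. L t \<in> parts) \<and> (\<forall>t. int M \<le> \<bar>t\<bar> \<longrightarrow> L t = (\<lambda>_. 0)) \<and>
     (\<forall>t\<ge>0. strip (even t) (L (t + 1)) (L t)) \<and> (\<forall>t\<le>0. strip (odd t) (L (t - 1)) (L t))}"

definition pyr :: "(int \<Rightarrow> nat \<Rightarrow> nat) \<Rightarrow> brick set" where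
  "pyr L = {slice_brick t i j | t i j. j < L t i}"

lemma slice_brick_mem_pyr [simp]: "slice_brick t i j \<in> pyr L \<longleftrightarrow> j < L t i"
  by (auto simp: pyr_def)

lemma pyr_eq_image:
  assumes "L \<in> slice_seqs M"
  shows "pyr L = (\<lambda>(t, i, j). slice_brick t i j) ` (SIGMA t:{- int M<..<int M}. {(i, j). j < L t i})"
proof -
  have "- int M < t \<and> t < int M" if "j < L t i" for t i j
  proof (rule ccontr)
    assume "\<not> ?thesis"
    then have "int M \<le> \<bar>t\<bar>" by linarith
    then have "L t = (\<lambda>_. 0)" using assms by (simp add: slice_seqs_def)
    with that show False by simp
  qed
  then show ?thesis by (force simp: pyr_def)
qed

lemma hstripD: "strip True g f \<Longrightarrow> f (Suc i) \<le> g i"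
  and vstripD: "strip False g f \<Longrightarrow> f i \<le> Suc (g i)"
  by (simp_all add: strip_def hstrip_def vstrip_def)

lemma pyr_in_pyramid_partitions:
  assumes "L \<in> slice_seqs M"
  shows "pyr L \<in> pyramid_partitions 1"
proof -
  have right: "strip (even t) (L (t + 1)) (L t)" if "t \<ge> 0" for t
    using assms that by (simp add: slice_seqs_def)
  have left: "strip (odd t) (L (t - 1)) (L t)" if "t \<le> 0" for t
    using assms that by (simp add: slice_seqs_def)
  have "finite (pyr L)"
    unfolding pyr_eq_image[OF assms]
    by (intro finite_imageI finite_SigmaI finite_cells) (use assms in \<open>auto simp: slice_seqs_def\<close>)
  moreover have "pyr L \<subseteq> empty_room 1"
    using slice_brick_in_empty_room by (auto simp: pyr_def)
  moreover have "A \<in> pyr L" if mem: "B \<in> pyr L" "A \<in> empty_room 1" "rests_upon A B" for A B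
  proof -
    obtain t i j where A: "A = slice_brick t i j"
      using empty_room_slice_brick[OF mem(2)] by blast
    obtain t' i' j' where B: "B = slice_brick t' i' j'" "j' < L t' i'"
      using mem(1) by (auto simp: pyr_def)
    from mem(3) consider
        "t \<ge> 0" "t' = t + 1" "i' = i" "j' = j"
      | "t \<le> 0" "t' = t - 1" "i' = i" "j' = j"
      | "t < 0" "t' = t + 1" "odd t" "i' = i" "j' = Suc j"
      | "t < 0" "t' = t + 1" "even t" "i' = Suc i" "j' = j"
      | "t > 0" "t' = t - 1" "odd t" "i' = Suc i" "j' = j"
      | "t > 0" "t' = t - 1" "even t" "i' = i" "j' = Suc j"
      unfolding A B(1) rests_upon_slice_brick_iff by (auto split: if_splits)
    then have "j < L t i"
    proof cases
      case 1
      then show ?thesis using B(2) strip_le[OF right[of t], of i] by simp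
    next
      case 2
      then show ?thesis using B(2) strip_le[OF left[of t], of i] by simp
    next
      case 3
      then show ?thesis using B(2) vstripD[of "L t" "L (t + 1)" i] left[of "t + 1"] by simp
    next
      case 4
      then show ?thesis using B(2) hstripD[of "L t" "L (t + 1)" i] left[of "t + 1"] by simp
    next
      case 5
      then show ?thesis using B(2) hstripD[of "L t" "L (t - 1)" i] right[of "t - 1"] by simp
    next
      case 6
      then show ?thesis using B(2) vstripD[of "L t" "L (t - 1)" i] right[of "t - 1"] by simp
    qed
    then show ?thesis by (simp add: A)
  qed
  ultimately show ?thesis unfolding pyramid_partitions_def by blast
qed

lemma pyramid_partition_eq_pyr:
  assumes "\<pi> \<in> pyramid_partitions 1"
    and bound: "\<And>t i j. slice_brick t i j \<in> \<pi> \<Longrightarrow> \<bar>t\<bar> < int M"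
  obtains L where "L \<in> slice_seqs M" "\<pi> = pyr L"
proof -
  define P where "P t i j \<longleftrightarrow> slice_brick t i j \<in> \<pi>" for t i j
  define L where "L t i = card {j. P t i j}" for t i
  have fin: "finite \<pi>" and room: "\<pi> \<subseteq> empty_room 1"
    using assms(1) by (simp_all add: pyramid_partitions_def)
  have closed: "P t i j" if "P t' i' j'" "rests_upon (slice_brick t i j) (slice_brick t' i' j')" for t i j t' i' j'
    using that assms(1) slice_brick_in_empty_room unfolding P_def pyramid_partitions_def by blast
  have right: "P t i j" if "P (t + 1) i j" "t \<ge> 0" for t i j
    by (rule closed[OF that(1)]) (use that(2) in \<open>simp add: rests_upon_slice_brick_iff\<close>)
  have left: "P t i j" if "P (t - 1) i j" "t \<le> 0" for t i j
    by (rule closed[OF that(1)]) (use that(2) in \<open>simp add: rests_upon_slice_brick_iff\<close>)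
  have right_h: "P (t + 1) i j" if "P t (Suc i) j" "t \<ge> 0" "even t" for t i j
    by (rule closed[OF that(1)]) (use that(2,3) in \<open>simp add: rests_upon_slice_brick_iff\<close>)
  have right_v: "P (t + 1) i j" if "P t i (Suc j)" "t \<ge> 0" "odd t" for t i j
    by (rule closed[OF that(1)]) (use that(2,3) in \<open>simp add: rests_upon_slice_brick_iff\<close>)
  have left_h: "P (t - 1) i j" if "P t (Suc i) j" "t \<le> 0" "odd t" for t i j
    by (rule closed[OF that(1)]) (use that(2,3) in \<open>simp add: rests_upon_slice_brick_iff\<close>)
  have left_v: "P (t - 1) i j" if "P t i (Suc j)" "t \<le> 0" "even t" for t i j
    by (rule closed[OF that(1)]) (use that(2,3) in \<open>simp add: rests_upon_slice_brick_iff\<close>)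
  have down_i: "P t i j" if "P t (Suc i) j" for t i j
  proof -
    consider "t \<ge> 0" "even t" | "t \<le> 0" "odd t" | "t - 1 \<ge> 0" "odd t" | "t + 1 \<le> 0" "even t"
      by linarith
    then show ?thesis
    proof cases
      case 1
      then show ?thesis using right_h right that by blast
    next
      case 2
      then show ?thesis using left_h left that by blast
    next
      case 3
      then show ?thesis using right_h[of "t - 1" i j] right[of "t - 1" "Suc i" j] that by simp
    next
      case 4
      then show ?thesis using left_h[of "t + 1" i j] left[of "t + 1" "Suc i" j] that by simp
    qed
  qed
  have down_j: "P t i j" if "P t i (Suc j)" for t i j
  proof -
    consider "t \<ge> 0" "odd t" | "t \<le> 0" "even t" | "t - 1 \<ge> 0" "even t" | "t + 1 \<le> 0" "odd t"
      by linarith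
    then show ?thesis
    proof cases
      case 1
      then show ?thesis using right_v right that by blast
    next
      case 2
      then show ?thesis using left_v left that by blast
    next
      case 3
      then show ?thesis using right_v[of "t - 1" i j] right[of "t - 1" i "Suc j"] that by simp
    next
      case 4
      then show ?thesis using left_v[of "t + 1" i j] left[of "t + 1" i "Suc j"] that by simp
    qed
  qed
  have down_j_le: "P t i j" if "P t i j'" "j \<le> j'" for t i j j'
    using that(2,1) by (induction rule: inc_induct) (auto intro: down_j)
  have finj: "finite {j. P t i j}" for t i
    unfolding P_def
    by (rule finite_vimageI[OF fin, of "slice_brick t i", unfolded vimage_def]) (simp add: inj_def)
  have P: "P t i j \<longleftrightarrow> j < L t i" for t i j
    using mem_iff_less_card[OF finj[of t i], of j] down_j_le by (auto simp: L_def)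
  have le: "L t i \<le> L t' i'" if "\<And>j. P t i j \<Longrightarrow> P t' i' j" for t i t' i'
    unfolding L_def by (rule card_mono[OF finj]) (use that in auto)
  have parts: "L t \<in> parts" for t
  proof -
    have "antimono (L t)" unfolding antimono_iff_le_Suc by (auto intro!: le down_i)
    moreover have "\<exists>n. \<forall>i\<ge>n. L t i = 0"
    proof -
      have "finite ((\<lambda>(i, j). slice_brick t i j) -` \<pi>)"
        by (rule finite_vimageI[OF fin]) (auto simp: inj_def)
      then have "finite (fst ` ((\<lambda>(i, j). slice_brick t i j) -` \<pi>))" by (rule finite_imageI)
      then obtain n where n: "\<forall>i\<in>fst ` ((\<lambda>(i, j). slice_brick t i j) -` \<pi>). i < n"
        using finite_nat_set_iff_bounded by blast
      have "\<not> P t i j" if "i \<ge> n" for i j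
      proof
        assume "P t i j"
        then have "i \<in> fst ` ((\<lambda>(i, j). slice_brick t i j) -` \<pi>)"
          by (intro image_eqI[of _ _ "(i, j)"]) (simp_all add: P_def)
        with n have "i < n" by (rule bspec)
        with that show False by simp
      qed
      then show ?thesis unfolding P by (intro exI[of _ n]) auto
    qed
    ultimately show ?thesis by (simp add: parts_def)
  qed
  have vle: "L t i \<le> Suc (L t' i)" if "\<And>j. P t i (Suc j) \<Longrightarrow> P t' i j" for t t' i
  proof (rule ccontr)
    assume "\<not> ?thesis"
    then have "P t i (Suc (L t' i))" by (simp add: P)
    from that[OF this] show False by (simp add: P)
  qed
  have "L \<in> slice_seqs M"
    unfolding slice_seqs_def
  proof (intro CollectI conjI allI impI)
    fix t assume "int M \<le> \<bar>t\<bar>"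
    then have "\<not> P t i j" for i j using bound[of t i j] by (auto simp: P_def)
    then show "L t = (\<lambda>_. 0)" by (simp add: L_def fun_eq_iff)
  next
    fix t :: int assume "0 \<le> t"
    then show "strip (even t) (L (t + 1)) (L t)"
      by (auto simp: strip_def hstrip_def vstrip_def intro!: le vle intro: right right_h right_v)
  next
    fix t :: int assume "t \<le> 0"
    then show "strip (odd t) (L (t - 1)) (L t)"
      by (auto simp: strip_def hstrip_def vstrip_def intro!: le vle intro: left left_h left_v)
  qed (rule parts)
  moreover have "\<pi> = pyr L"
  proof (intro equalityI subsetI)
    fix B assume "B \<in> \<pi>"
    moreover from this obtain t i j where "B = slice_brick t i j"
      using empty_room_slice_brick room by blast
    ultimately show "B \<in> pyr L" using P by (simp add: P_def)
  next
    fix B assume "B \<in> pyr L"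
    then show "B \<in> \<pi>" using P by (auto simp: P_def pyr_def)
  qed
  ultimately show thesis by (rule that)
qed

lemma inj_pyr: "inj pyr"
proof (rule injI, intro ext)
  fix L L' t i assume "pyr L = pyr L'"
  then have "j < L t i \<longleftrightarrow> j < L' t i" for j
    by (metis slice_brick_mem_pyr)
  then show "L t i = L' t i" by (meson less_irrefl nat_neq_iff)
qed

lemma card_pyr:
  assumes "L \<in> slice_seqs M"
  shows "card {B \<in> pyr L. even (fst B) = e} =
    (\<Sum>t\<in>{- int M<..<int M}. if even t = e then psize (L t) else 0)"
proof -
  have parts: "L t \<in> parts" for t using assms by (simp add: slice_seqs_def)
  have "{B \<in> pyr L. even (fst B) = e} = (\<lambda>(t, i, j). slice_brick t i j) `
      (SIGMA t:{t \<in> {- int M<..<int M}. even t = e}. {(i, j). j < L t i})"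
    unfolding pyr_eq_image[OF assms] by force
  moreover have "inj_on (\<lambda>(t, i, j). slice_brick t i j) X" for X
    by (auto simp: inj_on_def)
  ultimately have "card {B \<in> pyr L. even (fst B) = e} =
      card (SIGMA t:{t \<in> {- int M<..<int M}. even t = e}. {(i, j). j < L t i})"
    by (simp add: card_image)
  also have "\<dots> = (\<Sum>t\<in>{t \<in> {- int M<..<int M}. even t = e}. psize (L t))"
    unfolding psize_def
    by (rule card_SigmaI) (auto intro: finite_cells parts finite_subset[of _ "{- int M<..<int M}"])
  also have "\<dots> = (\<Sum>t\<in>{- int M<..<int M}. if even t = e then psize (L t) else 0)"
    by (rule sum.inter_filter) simp
  finally show ?thesis .
qed

section \<open>Slice sequences as paths\<close>

lemma mem_paths_iff:
  "ls \<in> paths ss \<mu> \<longleftrightarrow> length ls = length ss \<and>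
    (\<forall>p<length ss. ls ! p \<in> step_rel (fst (ss ! p)) (fst (snd (ss ! p))) ((\<mu> # ls) ! p)) \<and>
    last (\<mu> # ls) = (\<lambda>_. 0)"
proof (induction ss arbitrary: \<mu> ls)
  case (Cons s ss)
  obtain d h w where s: "s = (d, h, w)" by (cases s)
  show ?case
  proof (cases ls)
    case (Cons l ls')
    then show ?thesis
      by (auto simp: s Cons.IH All_less_Suc2)
  qed (auto simp: s)
qed auto

lemma path_weight_eq_prod:
  assumes "length ls = length ss"
  shows "path_weight ss \<mu> ls =
    (\<Prod>p<length ss. snd (snd (ss ! p)) ^ step_exp (fst (ss ! p)) ((\<mu> # ls) ! p) (ls ! p))"
  using assms
proof (induction ls ss arbitrary: \<mu> rule: list_induct2)
  case (Cons l ls s ss)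
  obtain d h w where s: "s = (d, h, w)" by (cases s)
  show ?case
    unfolding list.size(4) add_0_right add_Suc_right prod.lessThan_Suc_shift
    by (simp add: s Cons.IH)
qed simp

text \<open>
  Position \<open>p\<close> of a path of length \<open>2 * M\<close> holds the slice \<open>t = p - M + 1\<close>. Summation by parts turns
  slice weights into weights of size differences: the step into slice \<open>-a\<close> collects the slices
  \<open>-a, \<dots>, 0\<close>, and the step out of slice \<open>b\<close> collects the slices \<open>1, \<dots>, b\<close>.
\<close>

definition slice_wt :: "int \<Rightarrow> int fps fps" where
  "slice_wt t = (if even t then q0 else q1)"

definition up_wt :: "nat \<Rightarrow> int fps fps" where
  "up_wt a = (\<Prod>c\<le>a. slice_wt (- int c))"

definition down_wt :: "nat \<Rightarrow> int fps fps" where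
  "down_wt b = (\<Prod>c\<le>b. if c = 0 then 1 else slice_wt (int c))"

definition steps :: "nat \<Rightarrow> (bool \<times> bool \<times> int fps fps) list" where
  "steps M = map (\<lambda>p. (p < M, even (p + M), if p < M then up_wt (M - Suc p) else down_wt (p - M))) [0..<2 * M]"

definition to_path :: "nat \<Rightarrow> (int \<Rightarrow> nat \<Rightarrow> nat) \<Rightarrow> (nat \<Rightarrow> nat) list" where
  "to_path M L = map (\<lambda>p. L (int p - int M + 1)) [0..<2 * M]"

lemma length_steps [simp]: "length (steps M) = 2 * M"
  by (simp add: steps_def)

lemma length_to_path [simp]: "length (to_path M L) = 2 * M"
  by (simp add: to_path_def)

lemma nth_to_path: "p < 2 * M \<Longrightarrow> to_path M L ! p = L (int p - int M + 1)"
  by (simp add: to_path_def)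

lemma nth_Cons_to_path:
  assumes "L (- int M) = (\<lambda>_. 0)" "p \<le> 2 * M"
  shows "((\<lambda>_. 0) # to_path M L) ! p = L (int p - int M)"
  using assms by (cases p) (simp_all add: nth_to_path algebra_simps)

lemma steps_append:
  "steps M = map (\<lambda>(h, u). (True, h, u)) (map (\<lambda>a. (odd a, up_wt a)) (rev [0..<M])) @
    map (\<lambda>(h, y). (False, h, y)) (map (\<lambda>b. (even b, down_wt b)) [0..<M])" (is "_ = ?us @ ?ds")
proof (rule nth_equalityI)
  fix p assume "p < length (steps M)"
  then have p: "p < 2 * M" by simp
  show "steps M ! p = (?us @ ?ds) ! p"
  proof (cases "p < M")
    case True
    then have "odd (M - Suc p) \<longleftrightarrow> even (p + M)" by auto
    then show ?thesis using True by (simp add: steps_def nth_append rev_nth)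
  next
    case False
    then have "even (p - M) \<longleftrightarrow> even (p + M)" by auto
    then show ?thesis using False p by (simp add: steps_def nth_append)
  qed
qed simp

lemma up_wt_nth_0: "up_wt a $ 0 = 0"
proof -
  have "q0 dvd up_wt a"
    using dvd_prodI[of "{..a}" 0 "\<lambda>c. slice_wt (- int c)"] by (simp add: up_wt_def slice_wt_def)
  then show ?thesis by (simp add: q0_def fps_X_dvd_iff)
qed

lemma chain_steps:
  "foldr (\<lambda>(d, h, w). if d then up_op h w else down_op h w) (steps M) vac (\<lambda>_. 0) =
    (\<Prod>a<M. \<Prod>b<M. comm_factor (odd a = even b) (up_wt a * down_wt b))"
proof -
  let ?us = "map (\<lambda>a. (odd a, up_wt a)) (rev [0..<M])"
  let ?ds = "map (\<lambda>b. (even b, down_wt b)) [0..<M]"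
  have "foldr (\<lambda>(d, h, w). if d then up_op h w else down_op h w) (steps M) vac =
      foldr (\<lambda>(h, u). up_op h u) ?us (down_chain ?ds)"
    unfolding steps_append foldr_append foldr_map down_chain_def
    by (simp add: comp_def case_prod_unfold)
  moreover have "foldr (\<lambda>(h, u). up_op h u) ?us (down_chain ?ds) (\<lambda>_. 0) =
     (\<Prod>(h, u)\<leftarrow>?us. \<Prod>(h', y)\<leftarrow>?ds. comm_factor (h = h') (u * y)) * down_chain ?ds (\<lambda>_. 0)"
    by (rule up_chain_down_chain) (auto simp: up_wt_nth_0 zero_in_parts)
  moreover have "prod_list (map f [0..<M]) = (\<Prod>a<M. f a)" for f :: "nat \<Rightarrow> int fps fps"
    using prod.distinct_set_conv_list[of "[0..<M]" f] by (simp add: atLeast0LessThan)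
  ultimately show ?thesis
    by (simp add: down_chain_zero comp_def rev_map[symmetric] prod_list.rev)
qed

lemma last_Cons_eq_nth: "last (x # xs) = (x # xs) ! length xs"
  by (subst last_conv_nth) simp_all

lemma bij_betw_to_path:
  assumes "M > 0"
  shows "bij_betw (to_path M) (slice_seqs M) (paths (steps M) (\<lambda>_. 0))"
proof -
  have L0: "L t = (\<lambda>_. 0)" if "L \<in> slice_seqs M" "int M \<le> \<bar>t\<bar>" for L t
    using that by (simp add: slice_seqs_def)
  have rel: "step_rel (fst (steps M ! p)) (fst (snd (steps M ! p))) = step_rel (p < M) (even (p + M))"
    if "p < 2 * M" for p
    using that by (simp add: steps_def)
  have "inj_on (to_path M) (slice_seqs M)"
  proof (rule inj_onI, rule ext)
    fix L L' t assume L: "L \<in> slice_seqs M" "L' \<in> slice_seqs M" "to_path M L = to_path M L'"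
    show "L t = L' t"
    proof (cases "\<bar>t\<bar> < int M")
      case True
      define p where "p = nat (t + int M - 1)"
      have "p < 2 * M" "int p - int M + 1 = t" using True by (auto simp: p_def)
      then show ?thesis using L(3) nth_to_path by metis
    next
      case False
      then show ?thesis using L0 L(1,2) by simp
    qed
  qed
  moreover have "to_path M L \<in> paths (steps M) (\<lambda>_. 0)" if L: "L \<in> slice_seqs M" for L
    unfolding mem_paths_iff
  proof (intro conjI allI impI)
    have parts: "L t \<in> parts" for t using L by (simp add: slice_seqs_def)
    fix p assume "p < length (steps M)"
    then have p: "p < 2 * M" by simp
    have "L (int p - int M + 1) \<in> step_rel (p < M) (even (p + M)) (L (int p - int M))"
    proof (cases "p < M")
      case True
      define t where "t = int p - int M + 1"
      have "t \<le> 0" using True by (simp add: t_def)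
      then have "strip (odd t) (L (t - 1)) (L t)" using L by (simp add: slice_seqs_def)
      moreover have "odd t \<longleftrightarrow> even (p + M)" by (simp add: t_def)
      moreover have "t - 1 = int p - int M" by (simp add: t_def)
      ultimately show ?thesis using True parts by (simp add: step_rel_def t_def)
    next
      case False
      define t where "t = int p - int M"
      have "t \<ge> 0" using False by (simp add: t_def)
      then have "strip (even t) (L (t + 1)) (L t)" using L by (simp add: slice_seqs_def)
      moreover have "even t \<longleftrightarrow> even (p + M)" by (simp add: t_def)
      ultimately show ?thesis using False parts by (simp add: step_rel_def t_def)
    qed
    then show "to_path M L ! p \<in> step_rel (fst (steps M ! p)) (fst (snd (steps M ! p)))
        (((\<lambda>_. 0) # to_path M L) ! p)"
      using p by (simp add: rel nth_to_path nth_Cons_to_path L0[OF L] del: nth_Cons_Suc)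
  next
    show "last ((\<lambda>_. 0) # to_path M L) = (\<lambda>_. 0)"
      unfolding last_Cons_eq_nth length_to_path
      by (subst nth_Cons_to_path) (simp_all add: L0[OF L])
  qed simp
  moreover have "ls \<in> to_path M ` slice_seqs M" if ls: "ls \<in> paths (steps M) (\<lambda>_. 0)" for ls
  proof -
    define L where "L t = (if \<bar>t\<bar> < int M then ls ! nat (t + int M - 1) else (\<lambda>_. 0))" for t
    have len: "length ls = 2 * M" and last: "last ((\<lambda>_. 0) # ls) = (\<lambda>_. 0)"
      using ls by (simp_all add: mem_paths_iff)
    have step: "ls ! p \<in> step_rel (p < M) (even (p + M)) (((\<lambda>_. 0) # ls) ! p)" if "p < 2 * M" for p
      using ls that unfolding mem_paths_iff length_steps rel[OF that, symmetric] by blast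
    have end_zero: "ls ! (2 * M - 1) = (\<lambda>_. 0)"
    proof -
      have "Suc (2 * M - 1) = length ls" using len assms by simp
      with last show ?thesis unfolding last_Cons_eq_nth by (metis nth_Cons_Suc)
    qed
    have nth: "ls ! p = L (int p - int M + 1)" if "p < 2 * M" for p
    proof (cases "p = 2 * M - 1")
      case True
      then show ?thesis using end_zero assms by (simp add: L_def of_nat_diff)
    next
      case False
      then have "\<bar>int p - int M + 1\<bar> < int M" using that by linarith
      then show ?thesis by (simp add: L_def)
    qed
    have path: "to_path M L = ls"
    proof (rule nth_equalityI)
      fix p assume "p < length (to_path M L)"
      then have "p < 2 * M" by simp
      then show "to_path M L ! p = ls ! p" by (simp only: nth nth_to_path)
    qed (simp add: len)
    have "L (- int M) = (\<lambda>_. 0)" by (simp add: L_def)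
    then have nth0: "((\<lambda>_. 0) # ls) ! p = L (int p - int M)" if "p \<le> 2 * M" for p
      using nth_Cons_to_path[of L M p] that by (simp add: path)
    have "L \<in> slice_seqs M"
      unfolding slice_seqs_def
    proof (intro CollectI conjI allI impI)
      fix t
      show "L t \<in> parts"
      proof (cases "\<bar>t\<bar> < int M")
        case True
        then have "nat (t + int M - 1) < 2 * M" by linarith
        then show ?thesis using step True by (simp add: L_def step_rel_def)
      qed (simp add: L_def zero_in_parts)
    next
      fix t :: int assume t: "0 \<le> t"
      show "strip (even t) (L (t + 1)) (L t)"
      proof (cases "t < int M")
        case True
        define p where "p = nat (t + int M)"
        have p: "p < 2 * M" "\<not> p < M" "int p - int M = t" "even (p + M) \<longleftrightarrow> even t"
          using t True by (auto simp: p_def even_nat_iff nat_add_distrib)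
        show ?thesis using step[OF p(1)] p nth[OF p(1)] nth0[of p] by (simp add: step_rel_def)
      next
        case False
        then show ?thesis using t by (simp add: L_def strip_refl_zero)
      qed
    next
      fix t :: int assume t: "t \<le> 0"
      show "strip (odd t) (L (t - 1)) (L t)"
      proof (cases "- int M < t")
        case True
        define p where "p = nat (t + int M - 1)"
        have p: "p < M" "int p - int M = t - 1" using t True by (auto simp: p_def)
        then have "int (p + M) = t - 1 + 2 * int M" by simp
        then have "even (p + M) \<longleftrightarrow> odd t"
          by (metis even_of_nat even_add even_diff odd_one dvd_triv_left)
        then show ?thesis using step[of p] p nth[of p] nth0[of p] by (simp add: step_rel_def)
      next
        case False
        then show ?thesis using t by (simp add: L_def strip_refl_zero)
      qed
    qed (simp add: L_def)
    with path show ?thesis by blast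
  qed
  ultimately show ?thesis unfolding bij_betw_def by blast
qed

lemma prod_partial_products_power:
  fixes w :: "nat \<Rightarrow> 'a::comm_monoid_mult" and s :: "nat \<Rightarrow> nat"
  assumes "\<And>a. s (Suc a) \<le> s a"
  shows "(\<Prod>a<M. (\<Prod>c\<le>a. w c) ^ (s a - s (Suc a))) * (\<Prod>c<M. w c) ^ s M = (\<Prod>c<M. w c ^ s c)"
proof (induction M)
  case (Suc M)
  define Q where "Q a = (\<Prod>c\<le>a. w c)" for a
  have Q: "(\<Prod>c<Suc M. w c) = Q M" "Q M = (\<Prod>c<M. w c) * w M"
    by (simp_all add: Q_def lessThan_Suc_atMost[symmetric])
  have "(\<Prod>a<Suc M. Q a ^ (s a - s (Suc a))) * Q M ^ s (Suc M) =
      (\<Prod>a<M. Q a ^ (s a - s (Suc a))) * Q M ^ (s M - s (Suc M) + s (Suc M))"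
    by (simp add: power_add mult.assoc)
  also have "\<dots> = ((\<Prod>a<M. Q a ^ (s a - s (Suc a))) * (\<Prod>c<M. w c) ^ s M) * w M ^ s M"
    using assms[of M] by (simp add: Q(2) power_mult_distrib mult.assoc)
  also have "\<dots> = (\<Prod>c<Suc M. w c ^ s c)"
    using Suc.IH by (simp add: Q_def)
  finally show ?case unfolding Q(1) by (simp only: Q_def)
qed simp

lemma path_weight_to_path:
  assumes L: "L \<in> slice_seqs M"
  shows "path_weight (steps M) (\<lambda>_. 0) (to_path M L) = q0 ^ num_dark (pyr L) * q1 ^ num_light (pyr L)"
proof -
  have L0: "L t = (\<lambda>_. 0)" if "int M \<le> \<bar>t\<bar>" for t
    using L that by (simp add: slice_seqs_def)
  have parts: "L t \<in> parts" for t using L by (simp add: slice_seqs_def)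
  have psize0: "psize (\<lambda>_. 0) = 0" by (simp add: psize_def)
  define f where "f p = snd (snd (steps M ! p)) ^
      step_exp (fst (steps M ! p)) (((\<lambda>_. 0) # to_path M L) ! p) (to_path M L ! p)" for p
  have "path_weight (steps M) (\<lambda>_. 0) (to_path M L) = (\<Prod>p<2 * M. f p)"
    by (simp add: path_weight_eq_prod f_def)
  also have "\<dots> = (\<Prod>p<M. f p) * (\<Prod>b<M. f (b + M))"
    using prod.atLeastLessThan_concat[of 0 M "M + M" f] prod.shift_bounds_nat_ivl[of f 0 M M]
    by (simp add: atLeast0LessThan mult_2)
  also have "(\<Prod>p<M. f p) = (\<Prod>p<M. f (M - Suc p))"
    by (rule prod.nat_diff_reindex[symmetric])
  also have "\<dots> = (\<Prod>a<M. up_wt a ^ (psize (L (- int a)) - psize (L (- int (Suc a)))))"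
  proof (rule prod.cong)
    fix a assume "a \<in> {..<M}"
    then have a: "a < M" by simp
    then have "int (M - Suc a) - int M = - int (Suc a)" by simp
    then show "f (M - Suc a) = up_wt a ^ (psize (L (- int a)) - psize (L (- int (Suc a))))"
      using a by (simp add: f_def steps_def nth_to_path nth_Cons_to_path L0 step_exp_def)
  qed simp
  also have "\<dots> = (\<Prod>c<M. slice_wt (- int c) ^ psize (L (- int c)))"
  proof -
    have "psize (L (- int (Suc a))) \<le> psize (L (- int a))" for a
    proof -
      have "strip (odd t) (L (t - 1)) (L t)" if "t \<le> 0" for t
        using L that by (simp add: slice_seqs_def)
      from this[of "- int a"] have "strip (odd (- int a)) (L (- int a - 1)) (L (- int a))" by simp
      moreover have "- int a - 1 = - int (Suc a)" by simp
      ultimately show ?thesis using psize_mono[OF parts] strip_le by metis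
    qed
    from prod_partial_products_power[of "\<lambda>a. psize (L (- int a))", OF this, where w = "\<lambda>c. slice_wt (- int c)" and M = M]
    show ?thesis by (simp add: up_wt_def L0 psize0)
  qed
  also have "(\<Prod>b<M. f (b + M)) = (\<Prod>b<M. down_wt b ^ (psize (L (int b)) - psize (L (int (Suc b)))))"
    by (rule prod.cong)
      (simp_all add: f_def steps_def nth_to_path nth_Cons_to_path L0 step_exp_def del: nth_Cons_Suc, simp add: add.commute)
  also have "\<dots> = (\<Prod>c<M. (if c = 0 then 1 else slice_wt (int c)) ^ psize (L (int c)))"
  proof -
    have "psize (L (int (Suc b))) \<le> psize (L (int b))" for b
    proof -
      have "strip (even t) (L (t + 1)) (L t)" if "t \<ge> 0" for t
        using L that by (simp add: slice_seqs_def)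
      from this[of "int b"] have "strip (even (int b)) (L (int b + 1)) (L (int b))" by simp
      moreover have "int b + 1 = int (Suc b)" by simp
      ultimately show ?thesis using psize_mono[OF parts] strip_le by metis
    qed
    from prod_partial_products_power[of "\<lambda>a. psize (L (int a))", OF this,
        where w = "\<lambda>c. if c = 0 then 1 else slice_wt (int c)" and M = M]
    show ?thesis by (simp add: down_wt_def L0 psize0)
  qed
  also have "\<dots> = (\<Prod>c\<in>{1..<M}. slice_wt (int c) ^ psize (L (int c)))"
    by (rule prod.mono_neutral_cong_right) auto
  also have "(\<Prod>c<M. slice_wt (- int c) ^ psize (L (- int c))) * (\<Prod>c\<in>{1..<M}. slice_wt (int c) ^ psize (L (int c))) =
      (\<Prod>t\<in>{- int M<..<int M}. slice_wt t ^ psize (L t))"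
  proof -
    have "{- int M<..<int M} = (\<lambda>c. - int c) ` {..<M} \<union> int ` {1..<M}"
    proof (intro equalityI subsetI)
      fix t assume t: "t \<in> {- int M<..<int M}"
      show "t \<in> (\<lambda>c. - int c) ` {..<M} \<union> int ` {1..<M}"
      proof (cases "t \<le> 0")
        case True
        then show ?thesis using t by (intro UnI1 image_eqI[of _ _ "nat (- t)"]) auto
      next
        case False
        then show ?thesis using t by (intro UnI2 image_eqI[of _ _ "nat t"]) auto
      qed
    qed auto
    moreover have "(\<lambda>c. - int c) ` {..<M} \<inter> int ` {1..<M} = {}" by auto
    ultimately have "(\<Prod>t\<in>{- int M<..<int M}. slice_wt t ^ psize (L t)) =
        (\<Prod>t\<in>(\<lambda>c. - int c) ` {..<M}. slice_wt t ^ psize (L t)) * (\<Prod>t\<in>int ` {1..<M}. slice_wt t ^ psize (L t))"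
      by (simp add: prod.union_disjoint)
    then show ?thesis by (simp add: prod.reindex inj_on_def)
  qed
  also have "\<dots> = (\<Prod>t\<in>{- int M<..<int M}. q0 ^ (if even t = True then psize (L t) else 0) *
      q1 ^ (if even t = False then psize (L t) else 0))"
    by (rule prod.cong) (auto simp: slice_wt_def)
  also have "\<dots> = q0 ^ num_dark (pyr L) * q1 ^ num_light (pyr L)"
    using card_pyr[OF L, of True] card_pyr[OF L, of False]
    by (simp add: prod.distrib power_sum num_dark_def num_light_def)
  finally show ?thesis .
qed

lemma q_monomial_nth: "(q0 ^ m * q1 ^ n) $ i = (if i = m then fps_X ^ n else 0)"
  by (simp add: q0_def q1_def fps_X_power_mult_nth fps_const_power)

lemma fsum_q_monomials_nth:
  assumes "loc_fin (\<lambda>x. q0 ^ d x * q1 ^ l x) A"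
  shows "fsum (\<lambda>x. q0 ^ d x * q1 ^ l x) A $ i $ j = int (card {x \<in> A. d x = i \<and> l x = j})"
proof -
  have supp: "{x \<in> A. (q0 ^ d x * q1 ^ l x) $ i \<noteq> 0} = {x \<in> A. d x = i}"
    by (auto simp: q_monomial_nth)
  then have fin: "finite {x \<in> A. d x = i}" 
    using assms[unfolded loc_fin_def, rule_format, of i] by simp
  have "fsum (\<lambda>x. q0 ^ d x * q1 ^ l x) A $ i = (\<Sum>x\<in>{x \<in> A. d x = i}. (q0 ^ d x * q1 ^ l x) $ i)"
    by (rule fsum_nth) (auto simp: fin q_monomial_nth)
  also have "\<dots> = (\<Sum>x\<in>{x \<in> A. d x = i}. fps_X ^ l x)"
    by (rule sum.cong) (auto simp: q_monomial_nth)
  finally have "fsum (\<lambda>x. q0 ^ d x * q1 ^ l x) A $ i $ j = (\<Sum>x\<in>{x \<in> A. d x = i}. if j = l x then 1 else 0)"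
    by (simp add: fps_sum_nth fps_X_power_nth)
  also have "\<dots> = int (card {x \<in> {x \<in> A. d x = i}. j = l x})"
    unfolding sum.inter_filter[OF fin, symmetric] by simp
  also have "{x \<in> {x \<in> A. d x = i}. j = l x} = {x \<in> A. d x = i \<and> l x = j}" by auto
  finally show ?thesis .
qed

text \<open>
  Truncating at \<open>\<bar>t\<bar> < M\<close> is exact here: a brick of the slice \<open>t\<close> lies in a layer of depth at least
  \<open>\<bar>t\<bar>\<close>, and a pyramid partition is less deep than its number of bricks.
\<close>

lemma Z_1_nth:
  assumes "M > 0" "i + j \<le> M"
  shows "Z 1 $ i $ j = (\<Prod>a<M. \<Prod>b<M. comm_factor (odd a = even b) (up_wt a * down_wt b)) $ i $ j"
proof -
  let ?S = "slice_seqs M"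
  have pos: "w $ 0 = 0" if "(True, h, w) \<in> set (steps M)" for h w
    using that by (auto simp: steps_append up_wt_nth_0)
  note chain = chain_eq_fsum_paths[of "steps M" "\<lambda>_. 0", OF pos zero_in_parts]
  have bij: "bij_betw (inv_into ?S (to_path M)) (paths (steps M) (\<lambda>_. 0)) ?S"
    by (rule bij_betw_inv_into[OF bij_betw_to_path[OF assms(1)]])
  have weight: "path_weight (steps M) (\<lambda>_. 0) ls =
      q0 ^ num_dark (pyr (inv_into ?S (to_path M) ls)) * q1 ^ num_light (pyr (inv_into ?S (to_path M) ls))"
    if "ls \<in> paths (steps M) (\<lambda>_. 0)" for ls
  proof -
    have "ls \<in> to_path M ` ?S" using bij_betw_to_path[OF assms(1)] that by (simp add: bij_betw_def)
    then show ?thesis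
      using path_weight_to_path[of "inv_into ?S (to_path M) ls" M] by (simp add: inv_into_into f_inv_into_f)
  qed
  let ?w = "\<lambda>L. q0 ^ num_dark (pyr L) * q1 ^ num_light (pyr L)"
  have loc: "loc_fin ?w ?S"
    by (rule loc_fin_reindex[OF bij]) (rule iffD1[OF loc_fin_cong[OF refl weight] chain(1)])
  have "(\<Prod>a<M. \<Prod>b<M. comm_factor (odd a = even b) (up_wt a * down_wt b)) =
      fsum (path_weight (steps M) (\<lambda>_. 0)) (paths (steps M) (\<lambda>_. 0))"
    using chain(2) by (simp add: chain_steps)
  also have "\<dots> = fsum ?w ?S"
    unfolding fsum_reindex[OF bij, of ?w, symmetric] by (rule fsum_cong[OF refl weight])
  finally have "(\<Prod>a<M. \<Prod>b<M. comm_factor (odd a = even b) (up_wt a * down_wt b)) $ i $ j =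
      int (card {L \<in> ?S. num_dark (pyr L) = i \<and> num_light (pyr L) = j})"
    using fsum_q_monomials_nth[OF loc] by simp
  also have "card {L \<in> ?S. num_dark (pyr L) = i \<and> num_light (pyr L) = j} =
      card (pyr ` {L \<in> ?S. num_dark (pyr L) = i \<and> num_light (pyr L) = j})"
    by (rule card_image[symmetric]) (rule inj_on_subset[OF inj_pyr subset_UNIV])
  also have "pyr ` {L \<in> ?S. num_dark (pyr L) = i \<and> num_light (pyr L) = j} =
      {\<pi> \<in> pyramid_partitions 1. num_dark \<pi> = i \<and> num_light \<pi> = j}"
  proof (intro equalityI subsetI)
    fix \<pi> assume "\<pi> \<in> {\<pi> \<in> pyramid_partitions 1. num_dark \<pi> = i \<and> num_light \<pi> = j}"
    then have \<pi>: "\<pi> \<in> pyramid_partitions 1" "num_dark \<pi> = i" "num_light \<pi> = j" by auto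
    have fin: "finite \<pi>" using \<pi>(1) by (simp add: pyramid_partitions_def)
    have "\<pi> = {B \<in> \<pi>. even (fst B)} \<union> {B \<in> \<pi>. odd (fst B)}" by blast
    also have "card \<dots> = i + j"
      using fin \<pi>(2,3) unfolding num_dark_def num_light_def
      by (subst card_Un_disjoint) auto
    finally have card: "card \<pi> = i + j" .
    have "\<bar>t\<bar> < int M" if "slice_brick t a b \<in> \<pi>" for t a b
    proof -
      have "nat \<bar>t\<bar> + 2 * (a + b) < card \<pi>"
        using pyramid_partition_depth[OF \<pi>(1)] that unfolding slice_brick_def by blast
      then show ?thesis using card assms(2) by linarith
    qed
    with \<pi>(1) obtain L where "L \<in> ?S" "\<pi> = pyr L" by (rule pyramid_partition_eq_pyr)
    with \<pi> show "\<pi> \<in> pyr ` {L \<in> ?S. num_dark (pyr L) = i \<and> num_light (pyr L) = j}" by blast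
  qed (use pyr_in_pyramid_partitions in blast)
  finally show ?thesis by (simp add: Z_def)
qed

section \<open>Infinite products\<close>

definition fps_cong :: "nat \<Rightarrow> 'a::comm_ring_1 fps \<Rightarrow> 'a fps \<Rightarrow> bool" where
  "fps_cong N f g \<longleftrightarrow> fps_X ^ N dvd (f - g)"

lemma fps_cong_iff: "fps_cong N f g \<longleftrightarrow> (\<forall>k<N. f $ k = g $ k)"
  by (simp add: fps_cong_def fps_X_power_dvd_iff)

lemma fps_cong_refl: "fps_cong N f f"
  by (simp add: fps_cong_iff)

lemma fps_cong_sym: "fps_cong N f g \<Longrightarrow> fps_cong N g f"
  by (simp add: fps_cong_iff)

lemma fps_cong_trans: "fps_cong N f g \<Longrightarrow> fps_cong N g h \<Longrightarrow> fps_cong N f h"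
  by (simp add: fps_cong_iff)

lemma fps_cong_mono: "fps_cong N f g \<Longrightarrow> M \<le> N \<Longrightarrow> fps_cong M f g"
  by (simp add: fps_cong_iff)

lemma fps_cong_mult:
  assumes "fps_cong N f f'" "fps_cong N g g'"
  shows "fps_cong N (f * g) (f' * g')"
proof -
  have "f * g - f' * g' = (f - f') * g + f' * (g - g')" by (simp add: algebra_simps)
  then show ?thesis using assms unfolding fps_cong_def by (metis dvd_add dvd_mult dvd_mult2)
qed

lemma fps_cong_power: "fps_cong N f g \<Longrightarrow> fps_cong N (f ^ k) (g ^ k)"
  by (induction k) (simp_all add: fps_cong_refl fps_cong_mult)

lemma fps_cong_prod_1: "(\<And>x. x \<in> A \<Longrightarrow> fps_cong N (f x) 1) \<Longrightarrow> fps_cong N (prod f A) 1"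
proof (induction A rule: infinite_finite_induct)
  case (insert x A)
  then show ?case using fps_cong_mult[of N "f x" 1 "prod f A" 1] by simp
qed (simp_all add: fps_cong_refl)

lemma fps_cong_inv1:
  assumes "fps_cong N g 1" "g $ 0 = 1"
  shows "fps_cong N (fps_inv1 g) 1"
proof -
  have "fps_inv1 g - 1 = - fps_inv1 g * (g - 1)"
    using fps_inv1[OF assms(2)] by (simp add: algebra_simps)
  then show ?thesis using assms(1) by (simp add: fps_cong_def)
qed

lemma fps_cong_1_nth_0: "fps_cong (Suc N) g 1 \<Longrightarrow> g $ 0 = 1"
  by (simp add: fps_cong_iff)

lemma fps_eq_by_cong: "(\<And>N. fps_cong N f g) \<Longrightarrow> f = g"
  by (rule fps_ext) (metis fps_cong_iff lessI)

lemma prodinf_fps_cong: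
  fixes f :: "nat \<Rightarrow> 'a::idom fps"
  assumes "\<And>m. fps_cong (Suc m) (f m) 1"
  shows "fps_cong (Suc N) (prodinf f) (\<Prod>m<N. f m)"
proof -
  have stable: "fps_cong (Suc n) (\<Prod>m<n + d. f m) (\<Prod>m<n. f m)" for n d
  proof (induction d)
    case (Suc d)
    have "fps_cong (Suc n) (f (n + d)) 1"
      by (rule fps_cong_mono[OF assms]) simp
    from fps_cong_mult[OF Suc.IH this] show ?case by simp
  qed (simp add: fps_cong_refl)
  have stable_nth: "(\<Prod>m<n. f m) $ k = (\<Prod>m<k. f m) $ k" if "k \<le> n" for n k
    using stable[of k "n - k"] that by (simp add: fps_cong_iff)
  define P where "P = Abs_fps (\<lambda>k. (\<Prod>m<k. f m) $ k)"
  have "(\<lambda>n. \<Prod>m\<le>n. f m) \<longlonglongrightarrow> P"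
  proof (rule tendsto_fpsI)
    fix k
    show "\<forall>\<^sub>F n in sequentially. (\<Prod>m\<le>n. f m) $ k = P $ k"
      using eventually_ge_at_top[of k]
    proof eventually_elim
      case (elim n)
      then show ?case using stable_nth[of k "Suc n"] by (simp add: P_def lessThan_Suc_atMost)
    qed
  qed
  moreover have "P $ 0 \<noteq> 0" by (simp add: P_def)
  then have "P \<noteq> 0" by auto
  ultimately have "f has_prod P" by (simp add: has_prod_def raw_has_prod_def)
  then have "prodinf f = P" by (rule has_prod_unique[symmetric])
  then show ?thesis
    unfolding fps_cong_iff using stable_nth[of _ N] by (simp add: P_def less_Suc_eq_le)
qed

lemma prodinf_eqI:
  fixes f :: "nat \<Rightarrow> 'a::idom fps"
  assumes "\<And>m. fps_cong (Suc m) (f m) 1" "\<And>N. fps_cong (Suc N) g (\<Prod>m<N. f m)"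
  shows "g = prodinf f"
proof (rule fps_eq_by_cong)
  show "fps_cong N g (prodinf f)" for N
    by (rule fps_cong_mono[of "Suc N"],
        rule fps_cong_trans[OF assms(2) fps_cong_sym[OF prodinf_fps_cong[OF assms(1)]]]) simp
qed

lemma fps_inv1_prodinf:
  fixes g :: "nat \<Rightarrow> 'a::idom fps"
  assumes "\<And>m. fps_cong (Suc m) (g m) 1"
  shows "fps_inv1 (\<Prod>m. fps_inv1 (g m) ^ Suc m) = (\<Prod>m. g m ^ Suc m)"
proof (rule fps_inv1_unique)
  have cong_g: "fps_cong (Suc m) (g m ^ Suc m) 1" for m
    using fps_cong_power[OF assms, of m "Suc m"] by simp
  have cong_inv: "fps_cong (Suc m) (fps_inv1 (g m) ^ Suc m) 1" for m
    using fps_cong_power[OF fps_cong_inv1[OF assms fps_cong_1_nth_0[OF assms]], of m "Suc m"] by simp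
  show "(\<Prod>m. fps_inv1 (g m) ^ Suc m) $ 0 = 1"
    using prodinf_fps_cong[of "\<lambda>m. fps_inv1 (g m) ^ Suc m" 0, OF cong_inv] by (simp add: fps_cong_iff)
  show "(\<Prod>m. fps_inv1 (g m) ^ Suc m) * (\<Prod>m. g m ^ Suc m) = 1"
  proof (rule fps_eq_by_cong)
    fix N
    have "fps_cong (Suc N) ((\<Prod>m. fps_inv1 (g m) ^ Suc m) * (\<Prod>m. g m ^ Suc m))
        ((\<Prod>m<N. fps_inv1 (g m) ^ Suc m) * (\<Prod>m<N. g m ^ Suc m))"
      by (intro fps_cong_mult prodinf_fps_cong cong_g cong_inv)
    also have "(\<Prod>m<N. fps_inv1 (g m) ^ Suc m) * (\<Prod>m<N. g m ^ Suc m) = (\<Prod>m<N. (g m * fps_inv1 (g m)) ^ Suc m)"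
      unfolding prod.distrib[symmetric] power_mult_distrib[symmetric] by (simp only: mult.commute)
    also have "\<dots> = 1"
      by (simp add: fps_inv1 fps_cong_1_nth_0[OF assms] del: power_Suc)
    finally show "fps_cong N ((\<Prod>m. fps_inv1 (g m) ^ Suc m) * (\<Prod>m. g m ^ Suc m)) 1"
      by (rule fps_cong_mono) simp
  qed
qed

lemma up_wt_eq: "up_wt a = q0 ^ Suc (a div 2) * q1 ^ ((a + 1) div 2)"
proof (induction a)
  case 0
  show ?case by (simp add: up_wt_def slice_wt_def)
next
  case (Suc a)
  have "up_wt (Suc a) = up_wt a * slice_wt (- int (Suc a))" by (simp add: up_wt_def)
  then show ?case by (cases "even a") (auto simp: Suc slice_wt_def elim!: evenE oddE)
qed

lemma down_wt_eq: "down_wt b = q0 ^ (b div 2) * q1 ^ ((b + 1) div 2)"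
proof (induction b)
  case 0
  show ?case by (simp add: down_wt_def)
next
  case (Suc b)
  have "down_wt (Suc b) = down_wt b * slice_wt (int (Suc b))" by (simp add: down_wt_def)
  then show ?case by (cases "even b") (auto simp: Suc slice_wt_def elim!: evenE oddE)
qed

definition pair_factor :: "nat \<Rightarrow> nat \<Rightarrow> int fps fps" where
  "pair_factor a b = comm_factor (odd a = even b) (up_wt a * down_wt b)"

lemma up_down_wt: "up_wt a * down_wt b = q0 ^ Suc (a div 2 + b div 2) * q1 ^ ((a + 1) div 2 + (b + 1) div 2)"
  by (simp add: up_wt_eq down_wt_eq power_add mult_ac)

lemma fps_cong_pair_factor:
  assumes "2 * N \<le> a + b"
  shows "fps_cong N (pair_factor a b) 1"
proof -
  have "N \<le> Suc (a div 2 + b div 2)" using assms by linarith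
  then have "fps_X ^ N dvd up_wt a * down_wt b"
    unfolding up_down_wt q0_def by (intro dvd_mult2 le_imp_power_dvd)
  moreover have "(up_wt a * down_wt b) $ 0 = 0" by (simp add: up_wt_nth_0)
  ultimately show ?thesis
    unfolding pair_factor_def comm_factor_def
    by (auto simp: fps_cong_def intro!: fps_cong_inv1[unfolded fps_cong_def])
qed

lemma pair_factor_even_even:
  assumes "a + b = 2 * l" "even a"
  shows "pair_factor a b = 1 + q0 ^ Suc l * q1 ^ l"
proof -
  have "even b" using assms by presburger
  then obtain c d where "a = 2 * c" "b = 2 * d" using assms(2) by (elim evenE)
  moreover from this have "l = c + d" using assms(1) by simp
  ultimately show ?thesis by (simp add: pair_factor_def comm_factor_def up_down_wt)
qed

lemma pair_factor_odd_odd: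
  assumes "a + b = 2 * l" "odd a"
  shows "pair_factor a b = 1 + q0 ^ l * q1 ^ Suc l"
proof -
  have "odd b" using assms by presburger
  then obtain c d where "a = 2 * c + 1" "b = 2 * d + 1" using assms(2) by (elim oddE)
  moreover from this have "l = Suc (c + d)" using assms(1) by simp
  ultimately show ?thesis by (simp add: pair_factor_def comm_factor_def up_down_wt)
qed

lemma pair_factor_mixed:
  assumes "a + b = 2 * l + 1"
  shows "pair_factor a b = fps_inv1 (1 - (q0 * q1) ^ Suc l)"
proof -
  have "odd a = even b" using assms by presburger
  moreover have "a div 2 + b div 2 = l \<and> (a + 1) div 2 + (b + 1) div 2 = Suc l"
  proof (cases "even a")
    case True
    then obtain c d where "a = 2 * c" "b = 2 * d + 1" using calculation by (auto elim!: evenE oddE)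
    then show ?thesis using assms by simp
  next
    case False
    then obtain c d where "a = 2 * c + 1" "b = 2 * d" using calculation by (auto elim!: evenE oddE)
    then show ?thesis using assms by simp
  qed
  ultimately show ?thesis
    unfolding pair_factor_def comm_factor_def up_down_wt by (simp only: simp_thms if_True power_mult_distrib)
qed

lemma prod_alternating:
  fixes x y :: "'a::comm_monoid_mult"
  shows "(\<Prod>a\<le>2 * l. if even a then x else y) = x ^ Suc l * y ^ l"
  by (induction l) (simp_all add: mult_ac)

lemma prod_pairs: "(\<Prod>s<2 * N. h s) = (\<Prod>l<N. h (2 * l) * h (2 * l + 1))"
  for h :: "nat \<Rightarrow> 'a::comm_monoid_mult"
  by (induction N) (simp_all add: mult_ac)

abbreviation (input) factor_A :: "nat \<Rightarrow> int fps fps" where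
  "factor_A k \<equiv> (1 + q0 ^ Suc k * q1 ^ k) ^ Suc k"
abbreviation (input) factor_B :: "nat \<Rightarrow> int fps fps" where
  "factor_B k \<equiv> (1 + q0 ^ Suc k * q1 ^ (k + 2)) ^ Suc k"
abbreviation (input) factor_C :: "nat \<Rightarrow> int fps fps" where
  "factor_C k \<equiv> fps_inv1 (1 - 1 * (q0 * q1) ^ Suc k) ^ Suc k"

lemma prod_pair_factors:
  "fps_cong N (\<Prod>a<2 * N. \<Prod>b<2 * N. pair_factor a b)
    ((\<Prod>k<N. factor_C k) ^ 2 * (\<Prod>k<N. factor_A k) * (\<Prod>k<N. factor_B k))"
proof -
  let ?K = "2 * N"
  let ?B' = "\<lambda>l. (1 + q0 ^ l * q1 ^ Suc l) ^ l :: int fps fps"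
  let ?T = "{(a, b). a + b < ?K}"
  have diag_even: "(\<Prod>a\<le>2 * l. pair_factor a (2 * l - a)) = factor_A l * ?B' l" for l
  proof -
    have "(\<Prod>a\<le>2 * l. pair_factor a (2 * l - a)) =
        (\<Prod>a\<le>2 * l. if even a then 1 + q0 ^ Suc l * q1 ^ l else 1 + q0 ^ l * q1 ^ Suc l)"
      by (rule prod.cong) (auto simp del: power_Suc intro!: pair_factor_even_even pair_factor_odd_odd)
    then show ?thesis by (simp only: prod_alternating)
  qed
  have diag_odd: "(\<Prod>a\<le>2 * l + 1. pair_factor a (2 * l + 1 - a)) = factor_C l ^ 2" for l
  proof -
    have "(\<Prod>a\<le>2 * l + 1. pair_factor a (2 * l + 1 - a)) =
        (\<Prod>a\<le>2 * l + 1. fps_inv1 (1 - (q0 * q1) ^ Suc l))"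
      by (rule prod.cong) (auto simp del: power_Suc intro!: pair_factor_mixed)
    also have "\<dots> = fps_inv1 (1 - (q0 * q1) ^ Suc l) ^ Suc (2 * l + 1)"
      by (simp only: prod_constant card_atMost)
    also have "Suc (2 * l + 1) = Suc l * 2" by simp
    finally show ?thesis by (simp only: power_mult mult_1)
  qed
  have "(\<Prod>(a, b)\<in>?T. pair_factor a b) = (\<Prod>s<?K. \<Prod>a\<le>s. pair_factor a (s - a))"
    by (rule prod.triangle_reindex)
  also have "\<dots> = (\<Prod>l<N. factor_A l * ?B' l * factor_C l ^ 2)"
    unfolding prod_pairs diag_even diag_odd ..
  also have "\<dots> = (\<Prod>l<N. factor_C l) ^ 2 * (\<Prod>l<N. factor_A l) * (\<Prod>l<N. ?B' l)"
    by (simp only: prod.distrib prod_power_distrib[symmetric] mult_ac)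
  finally have T: "(\<Prod>(a, b)\<in>?T. pair_factor a b) =
      (\<Prod>l<N. factor_C l) ^ 2 * (\<Prod>l<N. factor_A l) * (\<Prod>l<N. ?B' l)" .
  have B: "fps_cong N (\<Prod>l<N. ?B' l) (\<Prod>l<N. factor_B l)"
  proof -
    have "fps_X ^ N dvd q0 ^ N * q1 ^ Suc N" by (simp add: q0_def)
    then have "fps_cong N (1 + q0 ^ N * q1 ^ Suc N) 1" by (simp add: fps_cong_def)
    then have "fps_cong N (?B' N) 1" using fps_cong_power by (metis power_one)
    from fps_cong_mult[OF fps_cong_refl[of N "\<Prod>l<N. ?B' l"] this]
    have "fps_cong N (\<Prod>l<Suc N. ?B' l) (\<Prod>l<N. ?B' l)" by simp
    moreover have "(\<Prod>l<Suc N. ?B' l) = (\<Prod>l<N. factor_B l)"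
      unfolding prod.lessThan_Suc_shift by (simp del: power_Suc)
    ultimately show ?thesis by (simp only: fps_cong_sym)
  qed
  have "fps_cong N (\<Prod>(a, b)\<in>{..<?K} \<times> {..<?K} - ?T. pair_factor a b) 1"
    by (rule fps_cong_prod_1) (auto intro!: fps_cong_pair_factor)
  from fps_cong_mult[OF this fps_cong_refl[of N "\<Prod>(a, b)\<in>?T. pair_factor a b"]]
  have "fps_cong N (\<Prod>(a, b)\<in>{..<?K} \<times> {..<?K}. pair_factor a b) (\<Prod>(a, b)\<in>?T. pair_factor a b)"
    by (subst prod.subset_diff[of ?T]) auto
  moreover have "fps_cong N (\<Prod>(a, b)\<in>?T. pair_factor a b)
      ((\<Prod>l<N. factor_C l) ^ 2 * (\<Prod>l<N. factor_A l) * (\<Prod>l<N. factor_B l))"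
    unfolding T by (intro fps_cong_mult fps_cong_refl B)
  ultimately show ?thesis
    unfolding prod.cartesian_product using fps_cong_trans by blast
qed

lemma fps_cong_1_plus: "fps_cong N (1 + fps_X ^ N * g) 1"
  by (simp add: fps_cong_def)

lemma fps_cong_1_minus: "fps_cong N (1 - fps_X ^ N * g) 1"
  by (simp add: fps_cong_def)

lemma fps_cong_factors:
  "fps_cong (Suc k) (factor_A k) 1" "fps_cong (Suc k) (factor_B k) 1" "fps_cong (Suc k) (factor_C k) 1"
proof -
  have "fps_cong (Suc k) (f ^ Suc k) 1" if "fps_cong (Suc k) f 1" for f :: "int fps fps"
    using fps_cong_power[OF that, of "Suc k"] by simp
  moreover have "fps_cong (Suc k) (1 - 1 * (q0 * q1) ^ Suc k) 1"
    unfolding q0_def power_mult_distrib mult_1 by (rule fps_cong_1_minus)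
  ultimately show "fps_cong (Suc k) (factor_A k) 1" "fps_cong (Suc k) (factor_B k) 1" "fps_cong (Suc k) (factor_C k) 1"
    using fps_cong_1_plus[of "Suc k"] fps_cong_inv1 fps_cong_1_nth_0 unfolding q0_def by blast+
qed

lemma Z_1_product:
  "Z 1 = MacMahon 1 (q0 * q1) ^ 2 * (\<Prod>k. factor_A k) * (\<Prod>k. factor_B k)"
proof (rule fps_ext, rule fps_ext)
  fix i j
  define N where "N = Suc (i + j)"
  have "Z 1 $ i $ j = (\<Prod>a<2 * N. \<Prod>b<2 * N. pair_factor a b) $ i $ j"
    unfolding pair_factor_def by (rule Z_1_nth) (simp_all add: N_def)
  also have "(\<Prod>a<2 * N. \<Prod>b<2 * N. pair_factor a b) $ i =
      ((\<Prod>k<N. factor_C k) ^ 2 * (\<Prod>k<N. factor_A k) * (\<Prod>k<N. factor_B k)) $ i"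
    using prod_pair_factors[of N] by (simp add: fps_cong_iff N_def)
  also have "\<dots> = (MacMahon 1 (q0 * q1) ^ 2 * (\<Prod>k. factor_A k) * (\<Prod>k. factor_B k)) $ i"
  proof -
    have "fps_cong (Suc N) (MacMahon 1 (q0 * q1) ^ 2 * (\<Prod>k. factor_A k) * (\<Prod>k. factor_B k))
        ((\<Prod>k<N. factor_C k) ^ 2 * (\<Prod>k<N. factor_A k) * (\<Prod>k<N. factor_B k))"
      unfolding MacMahon_def by (intro fps_cong_mult fps_cong_power prodinf_fps_cong fps_cong_factors)
    then show ?thesis by (simp add: fps_cong_iff N_def)
  qed
  finally show "Z 1 $ i $ j = (MacMahon 1 (q0 * q1) ^ 2 * (\<Prod>k. factor_A k) * (\<Prod>k. factor_B k)) $ i $ j" .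
qed

lemma to_laurent_nth: "to_laurent f $ k = fps_to_fls (f $ k)"
  by (simp add: to_laurent_def)

lemma fps_to_fls_sum: "fps_to_fls (sum f A) = (\<Sum>x\<in>A. fps_to_fls (f x))"
  for f :: "'b \<Rightarrow> 'a::comm_monoid_add fps"
  by (induction A rule: infinite_finite_induct) simp_all

lemma to_laurent_1: "to_laurent 1 = 1"
  by (rule fps_ext) (simp add: to_laurent_nth)

lemma to_laurent_add: "to_laurent (f + g) = to_laurent f + to_laurent g"
  by (rule fps_ext) (simp add: to_laurent_nth)

lemma to_laurent_diff: "to_laurent (f - g) = to_laurent f - to_laurent g"
  by (metis add_diff_cancel_right' diff_add_cancel to_laurent_add)

lemma to_laurent_mult: "to_laurent (f * g) = to_laurent f * to_laurent g"
  by (rule fps_ext) (simp add: to_laurent_nth fps_mult_nth fps_to_fls_sum fls_times_fps_to_fls)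

lemma to_laurent_power: "to_laurent (f ^ n) = to_laurent f ^ n"
  by (induction n) (simp_all add: to_laurent_1 to_laurent_mult)

lemma to_laurent_prod: "to_laurent (prod f A) = (\<Prod>x\<in>A. to_laurent (f x))"
  by (induction A rule: infinite_finite_induct) (simp_all add: to_laurent_1 to_laurent_mult)

lemma to_laurent_q0: "to_laurent q0 = l0"
  by (rule fps_ext) (simp add: to_laurent_nth q0_def l0_def)

lemma to_laurent_q1: "to_laurent q1 = l1"
  by (rule fps_ext) (simp add: to_laurent_nth q1_def l1_def)

lemma to_laurent_cong: "fps_cong N f g \<Longrightarrow> fps_cong N (to_laurent f) (to_laurent g)"
  by (simp add: fps_cong_iff to_laurent_nth)

lemma to_laurent_inv1: "f $ 0 = 1 \<Longrightarrow> to_laurent (fps_inv1 f) = fps_inv1 (to_laurent f)"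
  by (rule fps_inv1_unique[symmetric])
    (simp_all add: to_laurent_nth fps_inv1 to_laurent_1 flip: to_laurent_mult)

lemma to_laurent_prodinf:
  assumes "\<And>m. fps_cong (Suc m) (f m) 1"
  shows "to_laurent (prodinf f) = (\<Prod>m. to_laurent (f m))"
proof (rule prodinf_eqI)
  show "fps_cong (Suc m) (to_laurent (f m)) 1" for m
    using to_laurent_cong[OF assms[of m]] by (simp add: to_laurent_1)
  show "fps_cong (Suc N) (to_laurent (prodinf f)) (\<Prod>m<N. to_laurent (f m))" for N
    using to_laurent_cong[OF prodinf_fps_cong[of f N, OF assms]] by (simp add: to_laurent_prod)
qed

lemma l1_inv_l1: "l1_inv * l1 = 1"
proof -
  have "fls_X_inv * fls_X = (1 :: int fls)"
    by (simp only: fls_X_inv_times_conv_shift(1) fls_X_shift_to_one)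
  then show ?thesis by (simp add: l1_inv_def l1_def)
qed

theorem theorem1:
  shows "to_laurent (Z 1) = fps_inv1 (MacMahon (- l1_inv) (l0 * l1)) * Z_infinity l0 l1 \<and>
         Z 1 = MacMahon 1 (q0 * q1) ^ 2
               * (\<Prod>k. (1 + q0 ^ Suc k * q1 ^ k) ^ Suc k)
               * (\<Prod>k. (1 + q0 ^ Suc k * q1 ^ (k + 2)) ^ Suc k)"
proof
  show product: "Z 1 = MacMahon 1 (q0 * q1) ^ 2
               * (\<Prod>k. (1 + q0 ^ Suc k * q1 ^ k) ^ Suc k)
               * (\<Prod>k. (1 + q0 ^ Suc k * q1 ^ (k + 2)) ^ Suc k)"
    by (rule Z_1_product)
  note hom = to_laurent_1 to_laurent_add to_laurent_diff to_laurent_mult to_laurent_power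
    to_laurent_q0 to_laurent_q1
  have A: "to_laurent (\<Prod>k. factor_A k) = fps_inv1 (MacMahon (- l1_inv) (l0 * l1))"
  proof -
    have arg: "1 - (- l1_inv) * (l0 * l1) ^ Suc m = 1 + l0 ^ Suc m * l1 ^ m" for m
    proof -
      have "l1_inv * (l0 * l1) ^ Suc m = l0 ^ Suc m * l1 ^ m * (l1_inv * l1)"
        by (simp add: power_mult_distrib mult_ac)
      then show ?thesis by (simp add: l1_inv_l1)
    qed
    have "fps_inv1 (MacMahon (- l1_inv) (l0 * l1)) = (\<Prod>m. (1 + l0 ^ Suc m * l1 ^ m) ^ Suc m)"
      unfolding MacMahon_def arg by (rule fps_inv1_prodinf) (unfold l0_def, rule fps_cong_1_plus)
    also have "\<dots> = to_laurent (\<Prod>k. factor_A k)"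
      by (subst to_laurent_prodinf) (simp_all only: fps_cong_factors hom)
    finally show ?thesis ..
  qed
  have B: "to_laurent (\<Prod>k. factor_B k) = fps_inv1 (MacMahon (- l1) (l0 * l1))"
  proof -
    have arg: "1 - (- l1) * (l0 * l1) ^ Suc m = 1 + l0 ^ Suc m * l1 ^ (m + 2)" for m
      by (simp add: power_mult_distrib mult_ac)
    have "fps_inv1 (MacMahon (- l1) (l0 * l1)) = (\<Prod>m. (1 + l0 ^ Suc m * l1 ^ (m + 2)) ^ Suc m)"
      unfolding MacMahon_def arg by (rule fps_inv1_prodinf) (unfold l0_def, rule fps_cong_1_plus)
    also have "\<dots> = to_laurent (\<Prod>k. factor_B k)"
      by (subst to_laurent_prodinf) (simp_all only: fps_cong_factors hom)
    finally show ?thesis ..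
  qed
  have C: "to_laurent (MacMahon 1 (q0 * q1)) = MacMahon 1 (l0 * l1)"
  proof -
    have "(1 - 1 * (q0 * q1) ^ Suc m) $ 0 = 1" for m
      by (simp add: q0_def)
    then show ?thesis
      unfolding MacMahon_def
      by (subst to_laurent_prodinf) (simp_all only: fps_cong_factors hom to_laurent_inv1)
  qed
  have "to_laurent (Z 1) = MacMahon 1 (l0 * l1) ^ 2 *
      fps_inv1 (MacMahon (- l1_inv) (l0 * l1)) * fps_inv1 (MacMahon (- l1) (l0 * l1))"
    unfolding product by (simp only: hom A B C)
  then show "to_laurent (Z 1) = fps_inv1 (MacMahon (- l1_inv) (l0 * l1)) * Z_infinity l0 l1"
    by (simp only: Z_infinity_def mult_ac)
qed

end
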